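(* There exists a probability space containing a one-dimensional standard Brownian motion $B$ and a one-dimensional simple random walk $S$ (both started at $0$) such that for every function $g:\{1,2,\dots\}\to\mathbb{R}$ with $g(n)\geq 1$ for all $n$, there exist constants $b,K>0$ such that for all integers $n\ge 1$, $$\mathbb{P}\Big\{\sup_{0\leq t \leq n}|B(t) - S(t)|\geq n^{1/4}g(n)\Big\} \leq Kne^{-bg(n)}.$$
   Context: One-dimensional simple random walk is $S(n)=\sum_{i=1}^n X_i$ with $X_i$ independent and $\mathbb{P}\{X_i=1\}=\mathbb{P}\{X_i=-1\}=\frac12$. It is extended to real times $t\ge 0$ by linear interpolation: $S(t)=S([t])+(t-[t])(S([t]+1)-S([t]))$, with $[t]$ the integer part of $t$. The supremum is over real $t$. *)

theory Defs
  imports "HOL-Probability.Probability"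
begin

context prob_space
begin

text \<open>
  Processes are indexed by all reals, but only the times \<open>t \<ge> 0\<close> are constrained. Starting at 0 and
  path continuity are required at every sample point, not merely almost surely, so that
  suprema over compact time intervals are finite and measurable without completing the space.
\<close>

definition standard_brownian_motion :: "(real \<Rightarrow> 'a \<Rightarrow> real) \<Rightarrow> bool" where
  "standard_brownian_motion B \<longleftrightarrow>
     (\<forall>t\<ge>0. random_variable borel (B t)) \<and>
     (\<forall>\<omega>\<in>space M. B 0 \<omega> = 0) \<and>
     (\<forall>\<omega>\<in>space M. continuous_on {0..} (\<lambda>t. B t \<omega>)) \<and>
     (\<forall>s t. 0 \<le> s \<and> s < t \<longrightarrow>
        distributed M lborel (\<lambda>\<omega>. B t \<omega> - B s \<omega>) (normal_density 0 (sqrt (t - s)))) \<and>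
     (\<forall>(k::nat) (t :: nat \<Rightarrow> real). 0 \<le> t 0 \<and> (\<forall>i<k. t i \<le> t (Suc i)) \<longrightarrow>
        indep_vars (\<lambda>_. borel) (\<lambda>i \<omega>. B (t (Suc i)) \<omega> - B (t i) \<omega>) {..<k})"

definition simple_random_walk :: "(nat \<Rightarrow> 'a \<Rightarrow> real) \<Rightarrow> bool" where
  "simple_random_walk S \<longleftrightarrow>
     (\<exists>X :: nat \<Rightarrow> 'a \<Rightarrow> real.
        indep_vars (\<lambda>_. borel) X {1..} \<and>
        (\<forall>i\<ge>1. prob {\<omega> \<in> space M. X i \<omega> = 1} = 1 / 2 \<and>
                prob {\<omega> \<in> space M. X i \<omega> = -1} = 1 / 2) \<and>
        (\<forall>n. \<forall>\<omega>\<in>space M. S n \<omega> = (\<Sum>i=1..n. X i \<omega>)))"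

end

definition linear_interpolation :: "(nat \<Rightarrow> 'a \<Rightarrow> real) \<Rightarrow> real \<Rightarrow> 'a \<Rightarrow> real" where
  "linear_interpolation S t \<omega> =
     S (nat \<lfloor>t\<rfloor>) \<omega> + (t - of_int \<lfloor>t\<rfloor>) * (S (nat \<lfloor>t\<rfloor> + 1) \<omega> - S (nat \<lfloor>t\<rfloor>) \<omega>)"

end

theory Submission
  imports Defs "HOL-Real_Asymp.Real_Asymp"
begin

text \<open>
  Knight's construction. A simple random walk is refined by replacing each step with two steps in
  the same direction, preceded by a geometric number of excursions of length two that return to
  their starting point; the result is again a simple random walk. After \<open>2 j\<close> steps the refined walk
  is at twice the position of the coarse walk after \<open>N\<close> steps, where \<open>N\<close> is binomial with parameters
  \<open>j\<close> and \<open>1/2\<close>. By Hoeffding's inequality \<open>N\<close> differs from \<open>j/2\<close> by about \<open>sqrt j\<close>, so with time scaled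
  by \<open>1/4\<close> and space by \<open>1/2\<close>, the \<open>m\<close>-th refinement moves the path on \<open>[0, n]\<close> by about
  \<open>n powr (1/4) * 2 powr (- m/2)\<close>, with exponential tails. The rescaled walks therefore converge
  locally uniformly to a process at distance about \<open>n powr (1/4)\<close> from the original walk, and by the
  central limit theorem this limit is a Brownian motion. The union bounds lose a factor \<open>n\<^sup>2\<close>; taking
  square roots, which is allowed for probabilities, turns it into the factor \<open>n\<close> of the statement.
\<close>

section \<open>Fair coins\<close>

definition coin_sign :: "bool \<Rightarrow> real" where
  "coin_sign b = (if b then 1 else -1)"

lemma bool_set_cases: "S = {} \<or> S = UNIV \<or> S = {True} \<or> S = {False}" for S :: "bool set"
proof -
  have "S \<in> Pow {False, True}" by auto
  then show ?thesis by (auto simp: Pow_insert UNIV_bool)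
qed

context prob_space
begin

text \<open>Independence is encoded by probabilities of finite patterns, since \<open>refine\<close>
  turns suitable patterns into patterns with equally many coins. Independence as random variables is
  recovered in \<open>fair_coins_indep_vars\<close>.\<close>

definition fair_coins :: "('i \<Rightarrow> 'a \<Rightarrow> bool) \<Rightarrow> bool" where
  "fair_coins V \<longleftrightarrow> (\<forall>i. random_variable (count_space UNIV) (V i)) \<and>
     (\<forall>J a. finite J \<longrightarrow> prob {\<omega> \<in> space M. \<forall>i\<in>J. V i \<omega> = a i} = (1/2) ^ card J)"

lemma fair_coins_measurable:
  "fair_coins V \<Longrightarrow> random_variable (count_space UNIV) (V i)"
  by (simp add: fair_coins_def)

lemma fair_coins_prob:
  "fair_coins V \<Longrightarrow> finite J \<Longrightarrow> prob {\<omega> \<in> space M. \<forall>i\<in>J. V i \<omega> = a i} = (1/2) ^ card J"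
  by (simp add: fair_coins_def)

lemma fair_coins_prob_reindex:
  assumes "fair_coins V" "finite J" "inj_on f J"
  shows "prob {\<omega> \<in> space M. \<forall>i\<in>J. V (f i) \<omega> = a i} = (1/2) ^ card J"
proof -
  have "{\<omega> \<in> space M. \<forall>i\<in>J. V (f i) \<omega> = a i}
      = {\<omega> \<in> space M. \<forall>i\<in>f ` J. V i \<omega> = (a \<circ> inv_into J f) i}"
    using assms(3) by auto
  then show ?thesis
    using fair_coins_prob[OF assms(1), of "f ` J" "a \<circ> inv_into J f"] assms
    by (simp only: card_image finite_imageI)
qed

lemma fair_coins_reindex:
  assumes "fair_coins V" "inj f"
  shows "fair_coins (\<lambda>i. V (f i))"
  unfolding fair_coins_def
  using fair_coins_measurable[OF assms(1)] inj_on_subset[OF assms(2) subset_UNIV]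
  by (intro conjI allI impI fair_coins_prob_reindex[OF assms(1)]) auto

text \<open>Summing over the two values of one coin removes it from a pattern and doubles the
  probability, so large index sets determine the small ones. This lets row 0 of
  \<open>refine\<close> be examined on whole pairs of steps.\<close>

lemma fair_coinsI_cofinal:
  fixes V :: "'i \<Rightarrow> 'a \<Rightarrow> bool"
  assumes [measurable]: "\<And>i. random_variable (count_space UNIV) (V i)"
    and cofinal: "\<And>J. finite J \<Longrightarrow> \<exists>K. finite K \<and> J \<subseteq> K \<and>
       (\<forall>a. prob {\<omega> \<in> space M. \<forall>i\<in>K. V i \<omega> = a i} = (1/2) ^ card K)"
  shows "fair_coins V"
proof -
  define Q where "Q J \<longleftrightarrow> (\<forall>a. prob {\<omega> \<in> space M. \<forall>i\<in>J. V i \<omega> = a i} = (1/2) ^ card J)" for J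
  have down: "Q I" if Q: "Q (insert k I)" and "finite I" "k \<notin> I" for k I
    unfolding Q_def
  proof
    fix a
    let ?E = "\<lambda>b. {\<omega> \<in> space M. \<forall>i\<in>insert k I. V i \<omega> = (a(k := b)) i}"
    have "?E b \<in> events" for b
      by (intro sets.sets_Collect_finite_All) (measurable, simp add: that(2))
    have "{\<omega> \<in> space M. \<forall>i\<in>I. V i \<omega> = a i} = ?E True \<union> ?E False"
      using that(3) by auto
    moreover have "prob (?E True \<union> ?E False) = prob (?E True) + prob (?E False)"
      by (rule finite_measure_Union) (fact, fact, auto)
    moreover have "prob (?E b) = (1/2) ^ Suc (card I)" for b
      using Q that(2,3) unfolding Q_def card_insert_disjoint[OF that(2,3)] by blast
    ultimately have "prob {\<omega> \<in> space M. \<forall>i\<in>I. V i \<omega> = a i} = (1/2) ^ Suc (card I) + (1/2) ^ Suc (card I)"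
      by (simp only:)
    then show "prob {\<omega> \<in> space M. \<forall>i\<in>I. V i \<omega> = a i} = (1/2) ^ card I"
      by simp
  qed
  have all: "Q J" if "finite D" "finite J" "J \<inter> D = {}" "Q (J \<union> D)" for J D
    using that
  proof (induction D arbitrary: J rule: finite_induct)
    case (insert d D)
    have "Q (insert d J)"
      using insert.prems insert.hyps by (rule_tac insert.IH) auto
    then show ?case
      using insert.prems by (rule_tac down[of d J]) auto
  qed simp
  have "Q J" if "finite J" for J
  proof -
    obtain K where "finite K" "J \<subseteq> K" "Q K"
      using cofinal[OF \<open>finite J\<close>] unfolding Q_def by blast
    then show ?thesis
      using all[of "K - J" J] that by (auto simp: Un_absorb1)
  qed
  then show ?thesis
    by (simp add: fair_coins_def Q_def)
qed

text \<open>A set of Booleans is empty, full or a singleton. An empty factor makes both sides 0,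
  full factors drop out, and what remains is the probability of a pattern.\<close>

lemma fair_coins_indep_vars:
  fixes V :: "'i \<Rightarrow> 'a \<Rightarrow> bool"
  assumes V: "fair_coins V"
  shows "indep_vars (\<lambda>_. count_space UNIV) V I"
proof -
  note [measurable] = fair_coins_measurable[OF V]
  have "indep_sets (\<lambda>i. {V i -` A \<inter> space M | A. A \<in> sets (count_space UNIV)}) I"
  proof (rule indep_setsI)
    fix A J
    assume J: "J \<noteq> {}" "J \<subseteq> I" "finite J"
      and A: "\<forall>j\<in>J. A j \<in> {V j -` A \<inter> space M | A. A \<in> sets (count_space UNIV)}"
    obtain B where B: "\<And>j. j \<in> J \<Longrightarrow> A j = V j -` B j \<inter> space M"
    proof -
      have "\<forall>j\<in>J. \<exists>B. A j = V j -` B \<inter> space M" using A by auto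
      then show ?thesis using that by (auto dest!: bchoice)
    qed
    have P1: "prob (V j -` B j \<inter> space M) = (if B j = {} then 0 else if B j = UNIV then 1 else 1/2)" for j
    proof -
      have 1: "prob (V j -` {b} \<inter> space M) = 1/2" for b
        using fair_coins_prob[OF V, of "{j}" "\<lambda>_. b"] by (simp add: vimage_def Int_def conj_commute)
      have "{b} \<noteq> (UNIV :: bool set)" for b :: bool
        by (cases b) (auto simp: UNIV_bool)
      then show ?thesis
        using bool_set_cases[of "B j"] 1[of True] 1[of False] by (elim disjE) (simp_all add: prob_space)
    qed
    show "prob (\<Inter>j\<in>J. A j) = (\<Prod>j\<in>J. prob (A j))"
    proof (cases "\<exists>j\<in>J. B j = {}")
      case True
      then obtain j where j: "j \<in> J" "A j = {}" using B by auto
      then have "(\<Inter>j\<in>J. A j) = {}" by auto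
      moreover have "(\<Prod>j\<in>J. prob (A j)) = 0"
        using j J by (intro prod_zero bexI[of _ j]) auto
      ultimately show ?thesis by simp
    next
      case False
      define K where "K = {j\<in>J. B j \<noteq> UNIV}"
      have sing: "B j = {True \<in> B j}" if "j \<in> K" for j
        using that False bool_set_cases[of "B j"] by (auto simp: K_def)
      have "(\<Inter>j\<in>J. A j) = {\<omega> \<in> space M. \<forall>j\<in>J. V j \<omega> \<in> B j}"
        using J B by auto
      also have "\<dots> = {\<omega> \<in> space M. \<forall>j\<in>K. V j \<omega> \<in> B j}"
        by (auto simp: K_def)
      also have "\<dots> = {\<omega> \<in> space M. \<forall>j\<in>K. V j \<omega> = (True \<in> B j)}"
      proof -
        have "v \<in> B j \<longleftrightarrow> v = (True \<in> B j)" if "j \<in> K" for j v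
          using sing[OF that] by (cases v) auto
        then show ?thesis
          by (intro Collect_cong conj_cong ball_cong refl)
      qed
      also have "prob \<dots> = (1/2) ^ card K"
        using J by (intro fair_coins_prob[OF V]) (auto simp: K_def)
      also have "\<dots> = (\<Prod>j\<in>K. 1/2)" by simp
      also have "\<dots> = (\<Prod>j\<in>J. prob (A j))"
        using J False by (intro prod.mono_neutral_cong_left) (auto simp: K_def B P1 prob_space)
      finally show ?thesis .
    qed
  qed auto
  then show ?thesis
    unfolding indep_vars_def2 by auto
qed

lemma fair_coins_sign_indep_vars:
  "fair_coins V \<Longrightarrow> indep_vars (\<lambda>_. borel) (\<lambda>i \<omega>. coin_sign (V i \<omega>)) I"
  by (rule indep_vars_compose2[OF fair_coins_indep_vars]) auto

lemma fair_coins_prob_single: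
  assumes "fair_coins V"
  shows "prob {\<omega> \<in> space M. V i \<omega> = b} = 1/2"
  using fair_coins_prob[OF assms, of "{i}" "\<lambda>_. b"] by simp

text \<open>Banach values cover both real means and the complex exponentials of
  \<open>char_fair_coin_sum\<close>.\<close>

lemma fair_coins_integral:
  fixes f :: "bool \<Rightarrow> 'b :: {banach, second_countable_topology}"
  assumes V: "fair_coins V"
  shows "(LINT \<omega>|M. f (V i \<omega>)) = (1/2) *\<^sub>R f True + (1/2) *\<^sub>R f False"
proof -
  note [measurable] = fair_coins_measurable[OF V]
  have p: "prob {\<omega> \<in> space M. V i \<omega>} = 1/2" "prob {\<omega> \<in> space M. \<not> V i \<omega>} = 1/2"
    using fair_coins_prob_single[OF V, of i True] fair_coins_prob_single[OF V, of i False] by auto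
  have "(LINT \<omega>|M. f (V i \<omega>)) =
     (LINT \<omega>|M. indicator {\<omega> \<in> space M. V i \<omega> = True} \<omega> *\<^sub>R f True + indicator {\<omega> \<in> space M. V i \<omega> = False} \<omega> *\<^sub>R f False)"
    by (intro Bochner_Integration.integral_cong) (auto simp: indicator_def)
  also have "\<dots> = prob {\<omega> \<in> space M. V i \<omega>} *\<^sub>R f True + prob {\<omega> \<in> space M. \<not> V i \<omega>} *\<^sub>R f False"
    by (subst Bochner_Integration.integral_add) (auto simp: emeasure_eq_measure)
  also have "\<dots> = (1/2) *\<^sub>R f True + (1/2) *\<^sub>R f False"
    unfolding p ..
  finally show ?thesis .
qed

text \<open>An upper bound \<open>L\<close> for the number of coins enters the threshold, so that
  one threshold serves all index sets of a union bound.\<close>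

lemma fair_coins_Hoeffding:
  assumes V: "fair_coins V" and I: "finite I" "I \<noteq> {}" "real (card I) \<le> L" and y: "0 \<le> y"
  shows "prob {\<omega> \<in> space M. y * sqrt L \<le> \<bar>\<Sum>i\<in>I. coin_sign (V i \<omega>)\<bar>} \<le> 2 * exp (- (y\<^sup>2 / 2))"
proof -
  note [measurable] = fair_coins_measurable[OF V]
  have c: "card I > 0" using I by (simp add: card_gt_0_iff)
  have E: "(LINT \<omega>|M. coin_sign (V i \<omega>)) = 0" for i
    unfolding fair_coins_integral[OF V, of coin_sign] by (simp add: coin_sign_def)
  interpret Hoeffding_ineq M I "\<lambda>i \<omega>. coin_sign (V i \<omega>)" "\<lambda>_. -1" "\<lambda>_. 1" "\<Sum>i\<in>I. expectation (\<lambda>\<omega>. coin_sign (V i \<omega>))"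
    by unfold_locales (use I fair_coins_sign_indep_vars[OF V] in \<open>auto simp: coin_sign_def\<close>)
  have "prob {\<omega> \<in> space M. y * sqrt L \<le> \<bar>\<Sum>i\<in>I. coin_sign (V i \<omega>)\<bar>} \<le>
        prob {\<omega> \<in> space M. \<bar>(\<Sum>i\<in>I. coin_sign (V i \<omega>)) - 0\<bar> \<ge> y * sqrt (card I)}"
  proof (rule finite_measure_mono)
    have "y * sqrt (card I) \<le> y * sqrt L"
      using I y by (intro mult_left_mono) auto
    then show "{\<omega> \<in> space M. y * sqrt L \<le> \<bar>\<Sum>i\<in>I. coin_sign (V i \<omega>)\<bar>}
        \<subseteq> {\<omega> \<in> space M. \<bar>(\<Sum>i\<in>I. coin_sign (V i \<omega>)) - 0\<bar> \<ge> y * sqrt (card I)}"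
      by auto
  qed measurable
  also have "\<dots> \<le> 2 * exp (- 2 * (y * sqrt (card I))\<^sup>2 / (\<Sum>i\<in>I. (1 - (-1))\<^sup>2))"
    using Hoeffding_ineq_abs_ge[of "y * sqrt (card I)"] c y by (simp add: E)
  also have "- 2 * (y * sqrt (card I))\<^sup>2 / (\<Sum>i\<in>I. (1 - (-1))\<^sup>2) = - (y\<^sup>2 / 2)"
    using c by (simp add: power_mult_distrib)
  finally show ?thesis .
qed

end

section \<open>Refinement of a random walk\<close>

text \<open>
  In an array of coins \<open>V\<close>, row 0 holds the steps of the current walk and the rows from 1 on hold the
  randomness for the later refinements. The refinement reads row 1: the coin at \<open>2 j\<close> decides
  whether the \<open>j\<close>-th pair of new steps is a double step, whose direction is the next unused step of
  the coarse walk, or an excursion, whose direction is the coin at \<open>2 j + 1\<close>.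
\<close>

definition walk :: "(nat \<times> nat \<Rightarrow> 'a \<Rightarrow> bool) \<Rightarrow> nat \<Rightarrow> 'a \<Rightarrow> real" where
  "walk V k \<omega> = (\<Sum>i<k. coin_sign (V (0, i) \<omega>))"

definition double_count :: "(nat \<times> nat \<Rightarrow> 'a \<Rightarrow> bool) \<Rightarrow> nat \<Rightarrow> 'a \<Rightarrow> nat" where
  "double_count V j \<omega> = (\<Sum>i<j. of_bool (V (1, 2 * i) \<omega>))"

text \<open>The final equation yields \<open>d\<close> for the first step of a pair and for the
  second step of a double step, and the negation of \<open>d\<close> for the second step of an
  excursion. Row 2 of \<open>V\<close> becomes row 1, so the next refinement finds fresh coins
  there.\<close>

definition refine :: "(nat \<times> nat \<Rightarrow> 'a \<Rightarrow> bool) \<Rightarrow> nat \<times> nat \<Rightarrow> 'a \<Rightarrow> bool" where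
  "refine V = (\<lambda>(l, k) \<omega>. if l > 0 then V (Suc l, k) \<omega> else
     (let j = k div 2;
          d = (if V (1, 2 * j) \<omega> then V (0, double_count V j \<omega>) \<omega> else V (1, 2 * j + 1) \<omega>)
      in (even k \<or> V (1, 2 * j) \<omega>) = d))"

lemma refine_even:
  "refine V (0, 2 * j) \<omega> =
     (if V (1, 2 * j) \<omega> then V (0, double_count V j \<omega>) \<omega> else V (1, 2 * j + 1) \<omega>)"
  by (simp add: refine_def Let_def)

lemma refine_odd: "refine V (0, 2 * j + 1) \<omega> = (V (1, 2 * j) \<omega> = refine V (0, 2 * j) \<omega>)"
  unfolding refine_even by (simp add: refine_def Let_def)

lemma refine_positive: "l > 0 \<Longrightarrow> refine V (l, k) \<omega> = V (Suc l, k) \<omega>"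
  by (simp add: refine_def)

lemma double_count_0 [simp]: "double_count V 0 \<omega> = 0"
  by (simp add: double_count_def)

lemma double_count_Suc: "double_count V (Suc j) \<omega> = double_count V j \<omega> + of_bool (V (1, 2 * j) \<omega>)"
  by (simp add: double_count_def)

lemma double_count_le: "double_count V j \<omega> \<le> j"
  by (induction j) (auto simp: double_count_Suc)

text \<open>Doubling and centring the binomial count gives a sum of signs, to which
  \<open>fair_coins_Hoeffding\<close> applies.\<close>

lemma double_count_eq:
  "2 * real (double_count V j \<omega>) - real j = (\<Sum>i<j. coin_sign (V (1, 2 * i) \<omega>))"
  by (induction j) (auto simp: double_count_Suc coin_sign_def)

lemma walk_0 [simp]: "walk V 0 \<omega> = 0"
  by (simp add: walk_def)

lemma walk_Suc: "walk V (Suc k) \<omega> = walk V k \<omega> + coin_sign (V (0, k) \<omega>)"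
  by (simp add: walk_def)

lemma walk_diff: "a \<le> b \<Longrightarrow> walk V b \<omega> - walk V a \<omega> = (\<Sum>i\<in>{a..<b}. coin_sign (V (0, i) \<omega>))"
  by (simp add: walk_def sum_diff_nat_ivl[of 0 a b, symmetric] atLeast0LessThan[symmetric])

lemma walk_refine: "walk (refine V) (2 * j) \<omega> = 2 * walk V (double_count V j \<omega>) \<omega>"
proof (induction j)
  case (Suc j)
  have "walk (refine V) (2 * Suc j) \<omega> = walk (refine V) (2 * j) \<omega> +
      coin_sign (refine V (0, 2 * j) \<omega>) + coin_sign (refine V (0, 2 * j + 1) \<omega>)"
    by (simp add: walk_Suc)
  then show ?case
    unfolding Suc.IH refine_odd by (auto simp: double_count_Suc walk_Suc refine_even coin_sign_def)
qed simp

context prob_space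
begin

lemma double_count_measurable:
  assumes [measurable]: "\<And>p. random_variable (count_space UNIV) (V p)"
  shows "random_variable (count_space UNIV) (double_count V j)"
proof (induction j)
  case 0
  then show ?case by (simp add: double_count_def[abs_def])
next
  case (Suc j)
  note [measurable] = Suc
  have "double_count V (Suc j) =
      (\<lambda>\<omega>. if V (1, 2 * j) \<omega> then Suc (double_count V j \<omega>) else double_count V j \<omega>)"
    by (auto simp: double_count_Suc)
  then show ?case by simp
qed

lemma refine_measurable:
  assumes [measurable]: "\<And>p. random_variable (count_space UNIV) (V p)"
  shows "random_variable (count_space UNIV) (refine V p)"
proof -
  note [measurable] = double_count_measurable[of V, OF assms]
  \<comment> \<open>The coarse coin is read at a random place; countably many possible places keep
    it measurable.\<close>
  have [measurable]: "random_variable (count_space UNIV) (\<lambda>\<omega>. V (0, double_count V j \<omega>) \<omega>)" for j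
    by (rule measurable_compose_countable[where f = "\<lambda>i. V (0, i)"]) measurable
  show ?thesis
    by (cases p) (simp add: refine_def Let_def)
qed

text \<open>Prescribing finitely many steps of the refined walk fixes which pairs of steps are double
  steps, hence which steps of the coarse walk are read: it amounts to prescribing equally many,
  pairwise distinct coins.\<close>

lemma fair_coins_refine:
  assumes V: "fair_coins V"
  shows "fair_coins (refine V)"
proof (rule fair_coinsI_cofinal)
  show "random_variable (count_space UNIV) (refine V p)" for p
    by (rule refine_measurable[OF fair_coins_measurable[OF V]])
next
  fix J :: "(nat \<times> nat) set" assume J: "finite J"
  define F where "F = {p\<in>J. fst p > 0}"
  obtain n where n: "\<And>p. p \<in> J \<Longrightarrow> snd p < 2 * n"
  proof -
    obtain n where "\<And>k. k \<in> snd ` J \<Longrightarrow> k < n"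
      using J finite_nat_set_iff_bounded[of "snd ` J"] by blast
    then show ?thesis by (intro that[of n]) force
  qed
  \<comment> \<open>Row 0 is filled up to whole pairs, because the types of all earlier pairs decide
    which coarse coin a pair reads.\<close>
  define K where "K = {0::nat} \<times> {..<2 * n} \<union> F"
  have K: "finite K" "J \<subseteq> K"
    using J n by (auto simp: K_def F_def)
  have "prob {\<omega> \<in> space M. \<forall>p\<in>K. refine V p \<omega> = a p} = (1/2) ^ card K" for a
  proof -
    \<comment> \<open>The pattern \<open>a\<close> forces pair \<open>j\<close> to be double iff
      \<open>e j\<close>, and \<open>c j\<close> is then the value of \<open>double_count\<close>.
      In row 0, \<open>f\<close> sends the first step of a pair to the coin for its type and the
      second to the coin for its direction; \<open>b\<close> holds the values these coins must
      take.\<close>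
    define e where "e j = (a (0, 2 * j) = a (0, 2 * j + 1))" for j :: nat
    define c where "c j = (\<Sum>i<j. of_bool (e i) :: nat)" for j :: nat
    define f where "f = (\<lambda>(l, k). if l > 0 then (Suc l, k) else if even k then (1, k)
        else if e (k div 2) then (0, c (k div 2)) else (1::nat, k))"
    define b where "b = (\<lambda>(l, k). if l > 0 then a (l, k) else if even k then e (k div 2)
        else a (0, k - 1))"
    have c_Suc: "c (Suc j) = c j + of_bool (e j)" for j
      by (simp add: c_def)
    have c_mono: "i \<le> j \<Longrightarrow> c i \<le> c j" for i j
      by (rule lift_Suc_mono_le[of c]) (auto simp: c_Suc)
    \<comment> \<open>\<open>c\<close> increases past every double pair, so different double pairs
      read different coarse coins.\<close>
    have c_less: "c i < c j" if "i < j" "e i" for i j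
      using c_mono[of "Suc i" j] that by (simp add: c_Suc)
    have c_inj: "i = j" if "c i = c j" "e i" "e j" for i j
      using c_less[of i j] c_less[of j i] that by (metis less_irrefl nat_neq_iff)
    have inj: "inj_on f K"
    proof (rule inj_onI)
      fix p q assume pq: "p \<in> K" "q \<in> K" "f p = f q"
      obtain l k l' k' where [simp]: "p = (l, k)" "q = (l', k')" by (metis surj_pair)
      have "odd k \<Longrightarrow> odd k' \<Longrightarrow> k div 2 = k' div 2 \<Longrightarrow> k = k'"
        by presburger
      then show "p = q"
        using pq(3) c_inj[of "k div 2" "k' div 2"]
        by (auto simp: f_def split: if_splits)
    qed
    have key: "(\<forall>k<2*n. refine V (0, k) \<omega> = a (0, k)) \<longleftrightarrow> (\<forall>k<2*n. V (f (0, k)) \<omega> = b (0, k))" for \<omega>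
    proof -
      have split: "(\<forall>k<2*n. P k) \<longleftrightarrow> (\<forall>j<n. P (2 * j) \<and> P (2 * j + 1))" for P
      proof
        assume r: "\<forall>j<n. P (2 * j) \<and> P (2 * j + 1)"
        show "\<forall>k<2*n. P k"
        proof (intro allI impI)
          fix k assume "k < 2 * n"
          then show "P k"
            using r[rule_format, of "k div 2"] by (cases "even k") auto
        qed
      qed auto
      \<comment> \<open>Correct types before \<open>j\<close> fix the place of the coarse coin,
        which makes the two conditions agree pair by pair.\<close>
      have cnt: "double_count V j \<omega> = c j" if "\<forall>i<j. V (1, 2 * i) \<omega> = e i" for j
        unfolding double_count_def c_def using that by (intro sum.cong) auto
      have R: "(\<forall>k<2*n. V (f (0, k)) \<omega> = b (0, k)) \<longleftrightarrow>
          (\<forall>j<n. V (1, 2 * j) \<omega> = e j \<and> V (if e j then (0, c j) else (1, 2 * j + 1)) \<omega> = a (0, 2 * j))"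
        unfolding split by (simp add: f_def b_def)
      have L: "(\<forall>k<2*n. refine V (0, k) \<omega> = a (0, k)) \<longleftrightarrow>
          (\<forall>j<n. V (1, 2 * j) \<omega> = e j \<and> refine V (0, 2 * j) \<omega> = a (0, 2 * j))"
        unfolding split e_def refine_odd by auto
      show ?thesis
        unfolding L R
      proof (intro iffI allI impI)
        fix j assume A: "\<forall>j<n. V (1, 2 * j) \<omega> = e j \<and> refine V (0, 2 * j) \<omega> = a (0, 2 * j)" and j: "j < n"
        then have "double_count V j \<omega> = c j" by (intro cnt) auto
        then show "V (1, 2 * j) \<omega> = e j \<and> V (if e j then (0, c j) else (1, 2 * j + 1)) \<omega> = a (0, 2 * j)"
          using A j by (auto simp: refine_even)
      next
        fix j assume A: "\<forall>j<n. V (1, 2 * j) \<omega> = e j \<and> V (if e j then (0, c j) else (1, 2 * j + 1)) \<omega> = a (0, 2 * j)" and j: "j < n"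
        then have "double_count V j \<omega> = c j" by (intro cnt) auto
        then show "V (1, 2 * j) \<omega> = e j \<and> refine V (0, 2 * j) \<omega> = a (0, 2 * j)"
          using A j by (auto simp: refine_even)
      qed
    qed
    have F: "(\<forall>p\<in>F. refine V p \<omega> = a p) \<longleftrightarrow> (\<forall>p\<in>F. V (f p) \<omega> = b p)" for \<omega>
      by (auto simp: F_def refine_positive f_def b_def split: prod.splits)
    have "(\<forall>p\<in>K. refine V p \<omega> = a p) \<longleftrightarrow> (\<forall>p\<in>K. V (f p) \<omega> = b p)" for \<omega>
    proof -
      have "(\<forall>p\<in>K. P p) \<longleftrightarrow> (\<forall>k<2*n. P (0, k)) \<and> (\<forall>p\<in>F. P p)" for P
        by (auto simp: K_def)
      then show ?thesis using key F by simp
    qed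
    then show ?thesis
      using fair_coins_prob_reindex[OF V K(1) inj, of b] by simp
  qed
  then show "\<exists>K. finite K \<and> J \<subseteq> K \<and>
      (\<forall>a. prob {\<omega> \<in> space M. \<forall>p\<in>K. refine V p \<omega> = a p} = (1/2) ^ card K)"
    using K by blast
qed

lemma fair_coins_refine_iter: "fair_coins V \<Longrightarrow> fair_coins ((refine ^^ m) V)"
  by (induction m) (auto intro: fair_coins_refine)

lemma walk_measurable:
  assumes [measurable]: "\<And>p. random_variable (count_space UNIV) (V p)"
  shows "random_variable borel (walk V k)"
  unfolding walk_def[abs_def] coin_sign_def by measurable

end

section \<open>Distance between consecutive refinements\<close>

lemma abs_coin_sign [simp]: "\<bar>coin_sign b\<bar> = 1"
  by (simp add: coin_sign_def)

lemma nat_floor_double: "u \<ge> 0 \<Longrightarrow> nat \<lfloor>u\<rfloor> = nat \<lfloor>2 * u\<rfloor> div 2" for u :: real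
  by linarith

lemma nat_floor_quadruple:
  "u \<ge> 0 \<Longrightarrow> nat \<lfloor>4 * u\<rfloor> = 2 * nat \<lfloor>2 * u\<rfloor> \<or> nat \<lfloor>4 * u\<rfloor> = Suc (2 * nat \<lfloor>2 * u\<rfloor>)" for u :: real
  by linarith

lemma linear_interpolation_walk:
  assumes "t \<ge> 0"
  shows "linear_interpolation (walk V) t \<omega> =
    walk V (nat \<lfloor>t\<rfloor>) \<omega> + (t - of_int \<lfloor>t\<rfloor>) * coin_sign (V (0, nat \<lfloor>t\<rfloor>) \<omega>)"
  by (simp add: linear_interpolation_def walk_Suc)

lemma linear_interpolation_walk_floor:
  assumes "t \<ge> 0"
  shows "\<bar>linear_interpolation (walk V) t \<omega> - walk V (nat \<lfloor>t\<rfloor>) \<omega>\<bar> \<le> 1"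
proof -
  have "t - of_int \<lfloor>t\<rfloor> \<ge> 0" "t - of_int \<lfloor>t\<rfloor> \<le> 1" by linarith+
  then show ?thesis
    using assms by (simp add: linear_interpolation_walk abs_mult)
qed

text \<open>On a bounded interval the path is a finite sum of clipped ramps, one for each step, so
  no gluing at the integers arises.\<close>

lemma continuous_on_linear_interpolation_walk:
  "continuous_on {0..real N} (\<lambda>t. linear_interpolation (walk V) t \<omega>)"
proof -
  have "linear_interpolation (walk V) t \<omega> =
      (\<Sum>i<Suc N. coin_sign (V (0, i) \<omega>) * max 0 (min 1 (t - real i)))" if t: "t \<in> {0..real N}" for t
  proof -
    define k where "k = nat \<lfloor>t\<rfloor>"
    have k: "real k \<le> t" "t < real k + 1" "k \<le> N" "of_int \<lfloor>t\<rfloor> = real k"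
      using t unfolding k_def by (auto simp: nat_le_iff floor_le_iff)
    have "(\<Sum>i<Suc N. coin_sign (V (0, i) \<omega>) * max 0 (min 1 (t - real i))) =
        (\<Sum>i<Suc k. coin_sign (V (0, i) \<omega>) * max 0 (min 1 (t - real i)))"
      using k by (intro sum.mono_neutral_right) auto
    also have "\<dots> = walk V k \<omega> + coin_sign (V (0, k) \<omega>) * (t - real k)"
    proof -
      have "(\<Sum>i<k. coin_sign (V (0, i) \<omega>) * max 0 (min 1 (t - real i))) = walk V k \<omega>"
        unfolding walk_def using k by (intro sum.cong) (auto simp: min_def max_def)
      then show ?thesis using k by simp
    qed
    finally show ?thesis
      using t k by (simp add: linear_interpolation_walk flip: k_def)
  qed
  then show ?thesis
    by (subst continuous_on_cong[OF refl]) (auto intro!: continuous_intros)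
qed

text \<open>The walks are compared at the even time \<open>2 * j\<close>, where
  \<open>walk_refine\<close> is exact. Rounding \<open>4 * u\<close> to its floor and then to
  \<open>2 * j\<close> costs 1 each; rounding \<open>u\<close> costs 1, doubled by the factor 2.
  This makes 4.\<close>

lemma linear_interpolation_refine:
  assumes u: "u \<ge> 0"
  defines "j \<equiv> nat \<lfloor>2 * u\<rfloor>"
  shows "\<bar>linear_interpolation (walk (refine V)) (4 * u) \<omega> - 2 * linear_interpolation (walk V) u \<omega>\<bar>
    \<le> 4 + 2 * \<bar>walk V (double_count V j \<omega>) \<omega> - walk V (j div 2) \<omega>\<bar>"
proof -
  have "\<bar>linear_interpolation (walk (refine V)) (4 * u) \<omega> - walk (refine V) (nat \<lfloor>4 * u\<rfloor>) \<omega>\<bar> \<le> 1"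
    using u by (intro linear_interpolation_walk_floor) auto
  moreover have "\<bar>walk (refine V) (nat \<lfloor>4 * u\<rfloor>) \<omega> - walk (refine V) (2 * j) \<omega>\<bar> \<le> 1"
    using nat_floor_quadruple[OF u] by (auto simp: j_def walk_Suc)
  moreover have "\<bar>linear_interpolation (walk V) u \<omega> - walk V (j div 2) \<omega>\<bar> \<le> 1"
    using linear_interpolation_walk_floor[OF u, of V \<omega>] by (simp add: nat_floor_double[OF u] j_def)
  ultimately show ?thesis
    unfolding walk_refine by (smt (verit))
qed

context prob_space
begin

text \<open>Outside the first family of events \<open>double_count V j\<close> is within \<open>y * sqrt J\<close> of \<open>j / 2\<close>;
  outside the second the walk oscillates little over time spans of that length.\<close>

definition bad_event :: "(nat \<times> nat \<Rightarrow> 'a \<Rightarrow> bool) \<Rightarrow> nat \<Rightarrow> real \<Rightarrow> 'a set" where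
  "bad_event V J y =
     (\<Union>j\<in>{1..J}. {\<omega> \<in> space M. y * sqrt J \<le> \<bar>\<Sum>i<j. coin_sign (V (1, 2 * i) \<omega>)\<bar>}) \<union>
     (\<Union>(a, b)\<in>{(a, b). a < b \<and> b \<le> J \<and> real (b - a) \<le> y * sqrt J}.
        {\<omega> \<in> space M. y * sqrt (y * sqrt J) \<le> \<bar>\<Sum>i\<in>{a..<b}. coin_sign (V (0, i) \<omega>)\<bar>})"

lemma finite_bad_pairs:
  "finite {(a, b). a < b \<and> b \<le> J \<and> real (b - a) \<le> z}"
  "card {(a, b). a < b \<and> b \<le> J \<and> real (b - a) \<le> z} \<le> (J + 1)\<^sup>2"
proof -
  have sub: "{(a, b). a < b \<and> b \<le> J \<and> real (b - a) \<le> z} \<subseteq> {..J} \<times> {..J}" by auto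
  show "finite {(a, b). a < b \<and> b \<le> J \<and> real (b - a) \<le> z}"
    by (rule finite_subset[OF sub]) auto
  show "card {(a, b). a < b \<and> b \<le> J \<and> real (b - a) \<le> z} \<le> (J + 1)\<^sup>2"
    using card_mono[OF _ sub] by (simp add: card_cartesian_product power2_eq_square)
qed

lemma bad_event_measurable:
  assumes [measurable]: "\<And>p. random_variable (count_space UNIV) (V p)"
  shows "bad_event V J y \<in> events"
proof -
  have [measurable]: "(\<lambda>\<omega>. coin_sign (V p \<omega>)) \<in> borel_measurable M" for p
    unfolding coin_sign_def by measurable
  show ?thesis
    unfolding bad_event_def
    by (intro sets.Un sets.finite_UN) (auto intro!: finite_bad_pairs)
qed

text \<open>Hoeffding's inequality bounds each event by \<open>2 * exp (- (y\<^sup>2 / 2))\<close>,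
  with \<open>L = J\<close> in the first family and \<open>L = y * sqrt J\<close> in the second. The
  families have \<open>J\<close> and at most \<open>(J + 1)\<^sup>2\<close> members.\<close>

lemma prob_bad_event:
  assumes V: "fair_coins V" and J: "J \<ge> 1" and y: "y \<ge> 1"
  shows "prob (bad_event V J y) \<le> 10 * (real J)\<^sup>2 * exp (- (y\<^sup>2 / 2))"
proof -
  note [measurable] = fair_coins_measurable[OF V]
  have [measurable]: "(\<lambda>\<omega>. coin_sign (V p \<omega>)) \<in> borel_measurable M" for p
    unfolding coin_sign_def by measurable
  define e where "e = exp (- (y\<^sup>2 / 2))"
  let ?P = "{(a, b). a < b \<and> b \<le> J \<and> real (b - a) \<le> y * sqrt J}"
  let ?A = "\<lambda>j. {\<omega> \<in> space M. y * sqrt J \<le> \<bar>\<Sum>i<j. coin_sign (V (1, 2 * i) \<omega>)\<bar>}"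
  let ?B = "\<lambda>(a, b). {\<omega> \<in> space M. y * sqrt (y * sqrt J) \<le> \<bar>\<Sum>i\<in>{a..<b}. coin_sign (V (0, i) \<omega>)\<bar>}"
  have A: "prob (?A j) \<le> 2 * e" if "j \<in> {1..J}" for j
    using fair_coins_Hoeffding[OF fair_coins_reindex[OF V, of "\<lambda>i. (1, 2 * i)"], of "{..<j}" J y] that y
    by (auto simp: inj_on_def e_def lessThan_empty_iff)
  have B: "prob (?B p) \<le> 2 * e" if "p \<in> ?P" for p
    using fair_coins_Hoeffding[OF fair_coins_reindex[OF V, of "\<lambda>i. (0, i)"], of "{fst p..<snd p}" "y * sqrt J" y] that y
    by (auto simp: inj_on_def e_def)
  have "prob (bad_event V J y) \<le> prob (\<Union>j\<in>{1..J}. ?A j) + prob (\<Union>p\<in>?P. ?B p)"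
    unfolding bad_event_def
    by (intro measure_Un_le sets.finite_UN) (auto intro!: finite_bad_pairs)
  also have "prob (\<Union>j\<in>{1..J}. ?A j) \<le> (\<Sum>j\<in>{1..J}. prob (?A j))"
    by (intro finite_measure_subadditive_finite) auto
  also have "\<dots> \<le> (\<Sum>j\<in>{1..J}. 2 * e)"
    using A by (rule sum_mono)
  also have "prob (\<Union>p\<in>?P. ?B p) \<le> (\<Sum>p\<in>?P. prob (?B p))"
    by (intro finite_measure_subadditive_finite) (auto intro!: finite_bad_pairs)
  also have "\<dots> \<le> (\<Sum>p\<in>?P. 2 * e)"
    using B by (rule sum_mono)
  also have "\<dots> = real (card ?P) * (2 * e)" by simp
  also have "\<dots> \<le> real ((J + 1)\<^sup>2) * (2 * e)"
    by (intro mult_right_mono of_nat_mono finite_bad_pairs) (simp add: e_def)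
  also have "(\<Sum>j\<in>{1..J}. 2 * e) + real ((J + 1)\<^sup>2) * (2 * e) = 2 * (real J + (real J + 1)\<^sup>2) * e"
    by (simp add: algebra_simps)
  also have "\<dots> \<le> 2 * (5 * (real J)\<^sup>2) * e"
  proof -
    \<comment> \<open>The product equals \<open>5 * J\<^sup>2 - J - (J + 1)\<^sup>2\<close>.\<close>
    have "(real J - 1) * (4 * real J + 1) \<ge> 0" using J by simp
    then have "real J + (real J + 1)\<^sup>2 \<le> 5 * (real J)\<^sup>2"
      by (simp add: power2_eq_square algebra_simps)
    then show ?thesis by (simp add: e_def)
  qed
  finally show ?thesis by (simp add: e_def)
qed

text \<open>The two indices are at most \<open>y * sqrt J\<close> apart, and over such a span the
  walk moves by at most \<open>y * sqrt (y * sqrt J)\<close>. The final form uses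
  \<open>sqrt y \<le> y\<close>.\<close>

lemma not_bad_event:
  assumes J: "J \<ge> 1" and y: "y \<ge> 1" and \<omega>: "\<omega> \<in> space M" "\<omega> \<notin> bad_event V J y" and j: "j \<le> J"
  shows "\<bar>walk V (double_count V j \<omega>) \<omega> - walk V (j div 2) \<omega>\<bar> \<le> y\<^sup>2 * sqrt (sqrt J)"
proof -
  define a b where "a = min (double_count V j \<omega>) (j div 2)" and "b = max (double_count V j \<omega>) (j div 2)"
  have yJ: "y * sqrt J \<ge> 1"
    using mult_mono[of 1 y 1 "sqrt J"] J y by simp
  have "\<bar>\<Sum>i<j. coin_sign (V (1, 2 * i) \<omega>)\<bar> < y * sqrt J"
  proof (cases "j = 0")
    case False
    then have "j \<in> {1..J}" using j by auto
    then have "\<not> y * sqrt J \<le> \<bar>\<Sum>i<j. coin_sign (V (1, 2 * i) \<omega>)\<bar>"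
      using \<omega> unfolding bad_event_def by blast
    then show ?thesis by simp
  qed (use yJ in auto)
  then have "\<bar>2 * real (double_count V j \<omega>) - real j\<bar> < y * sqrt J"
    by (simp only: double_count_eq)
  \<comment> \<open>Rounding \<open>j / 2\<close> down costs at most \<open>1 / 2\<close>; the
    halved deviation leaves room for this, as \<open>y * sqrt J \<ge> 1\<close>.\<close>
  moreover have "real j - 1 \<le> 2 * real (j div 2)" "2 * real (j div 2) \<le> real j"
    by linarith+
  ultimately have "\<bar>real (double_count V j \<omega>) - real (j div 2)\<bar> \<le> y * sqrt J"
    using yJ by linarith
  then have ab: "real (b - a) \<le> y * sqrt J" "b \<le> J" "a \<le> b"
    using j double_count_le[of V j \<omega>] unfolding a_def b_def by (auto simp: min_def max_def of_nat_diff)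
  have "\<bar>walk V b \<omega> - walk V a \<omega>\<bar> \<le> y * sqrt (y * sqrt J)"
  proof (cases "a = b")
    case False
    then have "(a, b) \<in> {(a, b). a < b \<and> b \<le> J \<and> real (b - a) \<le> y * sqrt J}"
      using ab by auto
    then have "\<not> y * sqrt (y * sqrt J) \<le> \<bar>\<Sum>i\<in>{a..<b}. coin_sign (V (0, i) \<omega>)\<bar>"
      using \<omega> unfolding bad_event_def by blast
    then show ?thesis using ab by (simp add: walk_diff)
  qed (use y in auto)
  also have "y * sqrt (y * sqrt J) \<le> y * (y * sqrt (sqrt J))"
  proof -
    have "sqrt y \<le> y" using y by (intro real_le_lsqrt) (auto simp: power2_eq_square)
    then have "sqrt (y * sqrt J) \<le> y * sqrt (sqrt J)"
      by (simp add: real_sqrt_mult mult_right_mono)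
    then show ?thesis using y by simp
  qed
  finally show ?thesis
    by (auto simp: a_def b_def min_def max_def power2_eq_square abs_minus_commute split: if_splits)
qed

end

section \<open>The limit process\<close>

definition scaled_walk :: "(nat \<times> nat \<Rightarrow> 'a \<Rightarrow> bool) \<Rightarrow> nat \<Rightarrow> real \<Rightarrow> 'a \<Rightarrow> real" where
  "scaled_walk V m t \<omega> = linear_interpolation (walk ((refine ^^ m) V)) (4 ^ m * t) \<omega> / 2 ^ m"

text \<open>Space is divided by \<open>2 ^ m\<close>, while the fourth root of \<open>4 ^ m\<close>
  contributes \<open>sqrt 2 ^ m\<close>; this leaves the geometric factor. The linear factor comes
  from \<open>y\<^sup>2 = 2 * x + 8 * m\<close>.\<close>

definition step_bound :: "nat \<Rightarrow> real" where
  "step_bound m = 16 * real (Suc m) * (1 / sqrt 2) ^ m"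

lemma step_bound_nonneg: "step_bound m \<ge> 0"
  by (simp add: step_bound_def)

lemma summable_step_bound: "summable step_bound"
proof -
  have "step_bound = (\<lambda>m. 16 * (of_nat (Suc m) * (1 / sqrt 2) ^ m))"
    by (simp add: step_bound_def fun_eq_iff)
  moreover have "summable (\<lambda>m. 16 * (of_nat (Suc m) * (1 / sqrt 2) ^ m) :: real)"
    by (intro summable_mult sums_summable[OF geometric_deriv_sums]) (simp add: real_less_rsqrt)
  ultimately show ?thesis
    by (simp only:)
qed

lemma continuous_on_scaled_walk: "continuous_on {0..real N} (\<lambda>t. scaled_walk V m t \<omega>)"
proof -
  have "continuous_on ((\<lambda>t. 4 ^ m * t) ` {0..real N}) (\<lambda>t. linear_interpolation (walk ((refine ^^ m) V)) t \<omega>)"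
    by (rule continuous_on_subset[OF continuous_on_linear_interpolation_walk[of "4 ^ m * N"]]) auto
  then have "continuous_on {0..real N} (\<lambda>t. linear_interpolation (walk ((refine ^^ m) V)) (4 ^ m * t) \<omega>)"
    by (rule continuous_on_compose2) (auto intro!: continuous_intros)
  then show ?thesis
    unfolding scaled_walk_def by (intro continuous_intros) auto
qed

context prob_space
begin

lemma scaled_walk_measurable:
  assumes "\<And>p. random_variable (count_space UNIV) (V p)"
  shows "random_variable borel (scaled_walk V m t)"
proof -
  have "random_variable (count_space UNIV) ((refine ^^ m) V p)" for p
    using assms by (induction m arbitrary: p) (auto intro: refine_measurable)
  note [measurable] = walk_measurable[of "(refine ^^ m) V", OF this]
  show ?thesis
    unfolding scaled_walk_def[abs_def] linear_interpolation_def by measurable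
qed

text \<open>There are \<open>2 * 4 ^ m * n\<close> pairs of refined steps up to time \<open>n\<close>. The choice
  \<open>y\<^sup>2 = 2 * x + 8 * m\<close> makes each event in the union have probability about \<open>exp (- x - 4 * m)\<close>,
  which beats the number of events, of order \<open>16 ^ m * n\<^sup>2\<close>.\<close>

definition level_bad :: "(nat \<times> nat \<Rightarrow> 'a \<Rightarrow> bool) \<Rightarrow> nat \<Rightarrow> real \<Rightarrow> nat \<Rightarrow> 'a set" where
  "level_bad V n x m = bad_event ((refine ^^ m) V) (2 * 4 ^ m * n) (sqrt (2 * x + 8 * real m))"

lemma level_bad_measurable: "fair_coins V \<Longrightarrow> level_bad V n x m \<in> events"
  unfolding level_bad_def
  by (intro bad_event_measurable fair_coins_measurable fair_coins_refine_iter)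

lemma scaled_walk_step:
  assumes n: "n \<ge> 1" and x: "x \<ge> 1" and \<omega>: "\<omega> \<in> space M" "\<omega> \<notin> level_bad V n x m"
    and t: "0 \<le> t" "t \<le> real n"
  shows "\<bar>scaled_walk V (Suc m) t \<omega> - scaled_walk V m t \<omega>\<bar> \<le> x * real n powr (1/4) * step_bound m"
proof -
  define W where "W = (refine ^^ m) V"
  define u where "u = 4 ^ m * t"
  define j where "j = nat \<lfloor>2 * u\<rfloor>"
  define J where "J = 2 * 4 ^ m * n"
  define y where "y = sqrt (2 * x + 8 * real m)"
  define N where "N = real n powr (1/4)"
  have u: "u \<ge> 0" using t by (simp add: u_def)
  have J: "J \<ge> 1" using n by (simp add: J_def)
  have y: "y \<ge> 1" "y\<^sup>2 = 2 * x + 8 * real m" using x by (auto simp: y_def)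
  have N: "N \<ge> 1" using n by (simp add: N_def ge_one_powr_ge_zero)
  have "2 * u \<le> real J" using t by (simp add: u_def J_def)
  then have j: "j \<le> J" unfolding j_def by linarith
  have sJ: "sqrt (sqrt J) \<le> 2 * sqrt 2 ^ m * N"
  proof -
    have "sqrt (sqrt J) = sqrt (sqrt 2) * sqrt (sqrt (4 ^ m)) * sqrt (sqrt n)"
      by (simp add: J_def real_sqrt_mult)
    also have "sqrt (4 ^ m) = (2::real) ^ m"
      by (simp add: real_sqrt_power)
    also have "sqrt (2 ^ m) = sqrt 2 ^ m"
      by (simp add: real_sqrt_power)
    also have "sqrt (sqrt n) = N"
      by (simp add: N_def powr_powr flip: powr_half_sqrt)
    also have "sqrt (sqrt 2) \<le> 2"
      by (intro real_le_lsqrt) auto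
    finally show ?thesis using N by (simp add: mult_right_mono)
  qed
  have s2: "sqrt 2 ^ m \<ge> (1::real)" by simp
  have "\<bar>walk W (double_count W j \<omega>) \<omega> - walk W (j div 2) \<omega>\<bar> \<le> y\<^sup>2 * sqrt (sqrt J)"
    using \<omega> J y j unfolding level_bad_def W_def J_def y_def by (intro not_bad_event) auto
  also have "\<dots> \<le> (2 * x + 8 * real m) * (2 * sqrt 2 ^ m * N)"
    unfolding y(2) using sJ x by (intro mult_left_mono) auto
  \<comment> \<open>Factoring out \<open>x \<ge> 1\<close> makes the final bound linear in
    \<open>x\<close>, and hence the tail exponential.\<close>
  also have "2 * x + 8 * real m \<le> x * (2 + 8 * real m)"
    using x mult_right_mono[of 1 x "8 * real m"] by (simp add: algebra_simps)
  finally have "\<bar>walk W (double_count W j \<omega>) \<omega> - walk W (j div 2) \<omega>\<bar>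
      \<le> x * (2 + 8 * real m) * (2 * sqrt 2 ^ m * N)"
    using N by (simp add: mult_right_mono)
  \<comment> \<open>The rounding error 2 is at most twice this product, which brings the factor to
    \<open>6 + 16 * m\<close>, below \<open>16 * (m + 1)\<close>.\<close>
  moreover have "1 * 1 * 1 \<le> x * sqrt 2 ^ m * N"
    using x s2 N by (intro mult_mono) auto
  ultimately have "2 + \<bar>walk W (double_count W j \<omega>) \<omega> - walk W (j div 2) \<omega>\<bar>
      \<le> 2 * (x * sqrt 2 ^ m * N) + x * (2 + 8 * real m) * (2 * sqrt 2 ^ m * N)"
    by linarith
  also have "\<dots> = (6 + 16 * real m) * (x * sqrt 2 ^ m * N)"
    by (simp add: algebra_simps)
  also have "\<dots> \<le> 16 * real (Suc m) * (x * sqrt 2 ^ m * N)"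
    using x N by (intro mult_right_mono) auto
  finally have A: "2 + \<bar>walk W (double_count W j \<omega>) \<omega> - walk W (j div 2) \<omega>\<bar>
      \<le> 16 * real (Suc m) * (x * sqrt 2 ^ m * N)" .
  have "scaled_walk V (Suc m) t \<omega> - scaled_walk V m t \<omega> =
     (linear_interpolation (walk (refine W)) (4 * u) \<omega> - 2 * linear_interpolation (walk W) u \<omega>) / 2 ^ Suc m"
    by (simp add: scaled_walk_def W_def u_def field_simps)
  then have "\<bar>scaled_walk V (Suc m) t \<omega> - scaled_walk V m t \<omega>\<bar> =
     \<bar>linear_interpolation (walk (refine W)) (4 * u) \<omega> - 2 * linear_interpolation (walk W) u \<omega>\<bar> / 2 ^ Suc m"
    by simp
  also have "\<dots> \<le> (4 + 2 * \<bar>walk W (double_count W j \<omega>) \<omega> - walk W (j div 2) \<omega>\<bar>) / 2 ^ Suc m"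
    unfolding j_def by (intro divide_right_mono linear_interpolation_refine u) auto
  also have "\<dots> = (2 + \<bar>walk W (double_count W j \<omega>) \<omega> - walk W (j div 2) \<omega>\<bar>) / 2 ^ m"
    by (simp add: field_simps)
  also have "\<dots> \<le> 16 * real (Suc m) * (x * sqrt 2 ^ m * N) / 2 ^ m"
    using A by (rule divide_right_mono) simp
  also have "\<dots> = x * N * (16 * real (Suc m) * (sqrt 2 ^ m / 2 ^ m))"
    by simp
  also have "sqrt 2 ^ m / 2 ^ m = (1 / sqrt 2) ^ m"
  proof -
    have "sqrt 2 / 2 = 1 / sqrt 2" by (simp add: field_simps)
    then show ?thesis by (metis power_divide)
  qed
  finally show ?thesis by (simp add: N_def step_bound_def)
qed

lemma prob_level_bad:
  assumes V: "fair_coins V" and n: "n \<ge> 1" and x: "x \<ge> 1"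
  shows "prob (level_bad V n x m) \<le> 40 * (real n)\<^sup>2 * exp (- x) * (16 / 25) ^ m"
proof -
  have "prob (level_bad V n x m) \<le>
      10 * (real (2 * 4 ^ m * n))\<^sup>2 * exp (- ((sqrt (2 * x + 8 * real m))\<^sup>2 / 2))"
    unfolding level_bad_def using n x by (intro prob_bad_event fair_coins_refine_iter V) auto
  also have "- ((sqrt (2 * x + 8 * real m))\<^sup>2 / 2) = - x + real m * (- 4)"
    using x by (simp add: field_simps)
  also have "exp (- x + real m * (- 4)) = exp (- x) * exp (- 4) ^ m"
    by (simp only: exp_add exp_of_nat_mult)
  also have "10 * (real (2 * 4 ^ m * n))\<^sup>2 * (exp (- x) * exp (- 4) ^ m) =
      40 * (real n)\<^sup>2 * exp (- x) * (16 * exp (- 4)) ^ m"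
  proof -
    have "(16 :: real) ^ m = 4 ^ m * 4 ^ m" by (simp flip: power_mult_distrib)
    then show ?thesis by (simp only: power_mult_distrib power2_eq_square of_nat_mult of_nat_power) simp
  qed
  also have "\<dots> \<le> 40 * (real n)\<^sup>2 * exp (- x) * (16 / 25) ^ m"
  proof -
    \<comment> \<open>From \<open>exp 2 \<ge> 1 + 2 + 2\<close> follows
      \<open>exp 4 \<ge> 25\<close>, so the ratio \<open>16 * exp (- 4)\<close> is below 1 and the
      levels are summable.\<close>
    have "5 * 5 \<le> exp 2 * exp (2::real)"
      using exp_lower_Taylor_quadratic[of 2] by (intro mult_mono) auto
    then have "(25::real) \<le> exp 4" by (simp flip: exp_add)
    then have "exp (- 4) \<le> (1 / 25 :: real)"
      unfolding exp_minus by (simp add: field_simps)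
    then show ?thesis by (intro mult_left_mono power_mono) auto
  qed
  finally show ?thesis .
qed

lemma summable_prob_level_bad:
  assumes "fair_coins V" "n \<ge> 1" "x \<ge> 1"
  shows "summable (\<lambda>m. prob (level_bad V n x m))"
  by (rule summable_comparison_test[of _ "\<lambda>m. 40 * (real n)\<^sup>2 * exp (- x) * (16 / 25) ^ m"])
     (auto intro!: summable_mult summable_geometric exI[of _ 0] prob_level_bad assms)

lemma prob_level_bad_UN:
  assumes V: "fair_coins V" and n: "n \<ge> 1" and x: "x \<ge> 1"
  shows "prob (\<Union>m. level_bad V n x m) \<le> 121 * (real n)\<^sup>2 * exp (- x)"
proof -
  have s: "summable (\<lambda>m. 40 * (real n)\<^sup>2 * exp (- x) * (16 / 25 :: real) ^ m)"
    by (auto intro!: summable_mult summable_geometric)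
  have "prob (\<Union>m. level_bad V n x m) \<le> (\<Sum>m. prob (level_bad V n x m))"
    using level_bad_measurable[OF V] summable_prob_level_bad[OF assms]
    by (intro finite_measure_subadditive_countably) auto
  also have "\<dots> \<le> (\<Sum>m. 40 * (real n)\<^sup>2 * exp (- x) * (16 / 25) ^ m)"
    using s summable_prob_level_bad[OF assms] by (intro suminf_le prob_level_bad assms)
  also have "\<dots> = 40 * (real n)\<^sup>2 * exp (- x) * (1 / (1 - 16 / 25))"
    by (subst suminf_mult) (auto simp: suminf_geometric)
  \<comment> \<open>The constant is \<open>1000 / 9\<close>; it is enlarged to the square of 11 with
    the later square root in view.\<close>
  also have "\<dots> \<le> 121 * (real n)\<^sup>2 * exp (- x)"
    by simp
  finally show ?thesis .
qed

section \<open>Almost sure convergence and continuity of the limit\<close>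

definition good :: "(nat \<times> nat \<Rightarrow> 'a \<Rightarrow> bool) \<Rightarrow> 'a \<Rightarrow> bool" where
  "good V \<omega> \<longleftrightarrow> (\<forall>n\<ge>1. \<exists>m0. \<forall>m\<ge>m0. \<omega> \<notin> level_bad V n 1 m)"

lemma good_measurable:
  assumes "fair_coins V"
  shows "{\<omega> \<in> space M. good V \<omega>} \<in> events"
proof -
  note [measurable] = level_bad_measurable[OF assms]
  show ?thesis
    unfolding good_def by measurable
qed

text \<open>Borel-Cantelli at \<open>x = 1\<close>, for each of the countably many horizons
  \<open>n\<close>. Finitely many bad levels do no harm to convergence, so \<open>good\<close> only
  excludes infinitely many.\<close>

lemma AE_good:
  assumes V: "fair_coins V"
  shows "AE \<omega> in M. good V \<omega>"
proof -
  have "AE \<omega> in M. \<exists>m0. \<forall>m\<ge>m0. \<omega> \<notin> level_bad V n 1 m" if "n \<ge> 1" for n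
  proof -
    have "AE \<omega> in M. eventually (\<lambda>m. \<omega> \<in> space M - level_bad V n 1 m) sequentially"
      using level_bad_measurable[OF V] summable_prob_level_bad[OF V that, of 1]
      by (intro borel_cantelli_AE1) (auto simp: emeasure_eq_measure)
    then show ?thesis
      by eventually_elim (auto simp: eventually_sequentially)
  qed
  then show ?thesis
    unfolding good_def by (simp add: AE_all_countable)
qed

text \<open>The value 0 off the good event keeps every path continuous; that event has probability 1.\<close>

definition limit_process :: "(nat \<times> nat \<Rightarrow> 'a \<Rightarrow> bool) \<Rightarrow> real \<Rightarrow> 'a \<Rightarrow> real" where
  "limit_process V t \<omega> = (if good V \<omega> then lim (\<lambda>m. scaled_walk V m t \<omega>) else 0)"

lemma limit_process_measurable:
  assumes V: "fair_coins V"
  shows "random_variable borel (limit_process V t)"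
proof -
  note [measurable] = scaled_walk_measurable[OF fair_coins_measurable[OF V]] good_measurable[OF V]
  show ?thesis
    unfolding limit_process_def[abs_def] by measurable
qed

text \<open>The scaled walks are partial sums of their increments, which a multiple of the summable
  \<open>step_bound\<close> dominates from some level on, so the Weierstrass test applies.\<close>

lemma limit_process_uniform_limit:
  assumes \<omega>: "\<omega> \<in> space M" "good V \<omega>" and n: "n \<ge> 1"
  shows "uniform_limit {0..real n} (\<lambda>m t. scaled_walk V m t \<omega>) (\<lambda>t. limit_process V t \<omega>) sequentially"
proof -
  define d where "d m t = scaled_walk V (Suc m) t \<omega> - scaled_walk V m t \<omega>" for m t
  define g where "g t = scaled_walk V 0 t \<omega> + (\<Sum>m. d m t)" for t
  obtain m0 where m0: "\<And>m. m \<ge> m0 \<Longrightarrow> \<omega> \<notin> level_bad V n 1 m"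
    using \<omega>(2) n unfolding good_def by blast
  have "uniform_limit {0..real n} (\<lambda>m t. \<Sum>i<m. d i t) (\<lambda>t. \<Sum>i. d i t) sequentially"
  proof (rule Weierstrass_m_test_ev)
    show "\<forall>\<^sub>F m in sequentially. \<forall>t\<in>{0..real n}. norm (d m t) \<le> 1 * real n powr (1/4) * step_bound m"
      using eventually_ge_at_top[of m0]
    proof eventually_elim
      case (elim m)
      then show ?case
        using scaled_walk_step[OF n _ \<omega>(1) m0[OF elim]] by (auto simp: d_def)
    qed
    show "summable (\<lambda>m. 1 * real n powr (1/4) * step_bound m)"
      by (intro summable_mult summable_step_bound)
  qed
  then have "uniform_limit {0..real n} (\<lambda>m t. scaled_walk V 0 t \<omega> + (\<Sum>i<m. d i t)) g sequentially"
    unfolding g_def by (intro uniform_limit_add uniform_limit_const)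
  moreover have "scaled_walk V 0 t \<omega> + (\<Sum>i<m. d i t) = scaled_walk V m t \<omega>" for m t
    unfolding d_def by (subst sum_lessThan_telescope) simp
  ultimately have *: "uniform_limit {0..real n} (\<lambda>m t. scaled_walk V m t \<omega>) g sequentially"
    by simp
  have "limit_process V t \<omega> = g t" if "t \<in> {0..real n}" for t
    using limI[OF tendsto_uniform_limitI[OF * that]] \<omega> by (simp add: limit_process_def)
  then show ?thesis
    using * by (subst uniform_limit_cong'[where g = "\<lambda>m t. scaled_walk V m t \<omega>" and i = g]) auto
qed

lemma limit_process_tendsto:
  assumes "\<omega> \<in> space M" "good V \<omega>" "t \<ge> 0"
  shows "(\<lambda>m. scaled_walk V m t \<omega>) \<longlonglongrightarrow> limit_process V t \<omega>"
  using assms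
  by (intro tendsto_uniform_limitI[OF limit_process_uniform_limit[of \<omega> V "Suc (nat \<lceil>t\<rceil>)"]])
     (auto simp: le_nat_iff, linarith)

lemma limit_process_continuous:
  assumes "\<omega> \<in> space M"
  shows "continuous_on {0..} (\<lambda>t. limit_process V t \<omega>)"
proof (cases "good V \<omega>")
  case False
  then show ?thesis by (simp add: limit_process_def)
next
  case True
  have c: "continuous_on {0..real n} (\<lambda>t. limit_process V t \<omega>)" if "n \<ge> 1" for n
    by (rule uniform_limit_theorem[OF _ limit_process_uniform_limit[OF assms True that]])
       (auto intro!: always_eventually continuous_on_scaled_walk)
  show ?thesis
    unfolding continuous_on_eq_continuous_within
  proof
    fix t :: real assume t: "t \<in> {0..}"
    \<comment> \<open>This horizon is strictly beyond \<open>t\<close>, so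
      \<open>{0..real n}\<close> contains a neighbourhood of \<open>t\<close> in the
      half-line.\<close>
    define n where "n = Suc (nat \<lceil>t\<rceil>)"
    have n: "t < real n" "n \<ge> 1" using t unfolding n_def by (auto, linarith)
    have "continuous (at t within {0..} \<inter> {..<real n}) (\<lambda>t. limit_process V t \<omega>)"
      by (rule continuous_within_subset[of t "{0..real n}"])
         (use c[OF n(2)] n t in \<open>auto simp: continuous_on_eq_continuous_within\<close>)
    moreover have "at t within {0..} \<inter> {..<real n} = at t within {0..}"
      using n by (intro at_within_nhd[of t "{..<real n}"]) auto
    ultimately show "continuous (at t within {0..}) (\<lambda>t. limit_process V t \<omega>)"
      by simp
  qed
qed

section \<open>Tail bound for the distance to the original walk\<close>

lemma limit_process_close:
  assumes \<omega>: "\<omega> \<in> space M" "good V \<omega>" and n: "n \<ge> 1" and x: "x \<ge> 1"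
    and nb: "\<omega> \<notin> (\<Union>m. level_bad V n x m)" and t: "t \<in> {0..real n}"
  shows "\<bar>limit_process V t \<omega> - linear_interpolation (walk V) t \<omega>\<bar>
    \<le> suminf step_bound * x * real n powr (1/4)"
proof (rule Lim_bounded)
  \<comment> \<open>Level 0 is the original walk, so the distance is bounded by summing the
    increments of all levels, none of which is bad.\<close>
  have "scaled_walk V 0 t \<omega> = linear_interpolation (walk V) t \<omega>"
    by (simp add: scaled_walk_def)
  then show "(\<lambda>m. \<bar>scaled_walk V m t \<omega> - scaled_walk V 0 t \<omega>\<bar>)
      \<longlonglongrightarrow> \<bar>limit_process V t \<omega> - linear_interpolation (walk V) t \<omega>\<bar>"
    using limit_process_tendsto[OF \<omega>, of t] t by (auto intro!: tendsto_intros)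
  show "\<forall>m\<ge>0. \<bar>scaled_walk V m t \<omega> - scaled_walk V 0 t \<omega>\<bar> \<le> suminf step_bound * x * real n powr (1/4)"
  proof (intro allI impI)
    fix m
    have "\<bar>scaled_walk V m t \<omega> - scaled_walk V 0 t \<omega>\<bar>
        = \<bar>\<Sum>i<m. scaled_walk V (Suc i) t \<omega> - scaled_walk V i t \<omega>\<bar>"
      by (subst sum_lessThan_telescope) simp
    also have "\<dots> \<le> (\<Sum>i<m. x * real n powr (1/4) * step_bound i)"
      using scaled_walk_step[OF n x \<omega>(1)] nb t
      by (intro order_trans[OF sum_abs] sum_mono) auto
    also have "\<dots> = x * real n powr (1/4) * (\<Sum>i<m. step_bound i)"
      by (simp add: sum_distrib_left)
    also have "\<dots> \<le> x * real n powr (1/4) * suminf step_bound"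
      using x by (intro mult_left_mono sum_le_suminf summable_step_bound) (auto simp: step_bound_nonneg)
    finally show "\<bar>scaled_walk V m t \<omega> - scaled_walk V 0 t \<omega>\<bar> \<le> suminf step_bound * x * real n powr (1/4)"
      by (simp add: mult_ac)
  qed
qed

lemma prob_limit_process_far:
  assumes V: "fair_coins V" and n: "n \<ge> 1" and z: "z \<ge> 1"
  defines "C \<equiv> suminf step_bound + 1"
  shows "prob {\<omega> \<in> space M. (SUP t\<in>{0..real n}. \<bar>limit_process V t \<omega> - linear_interpolation (walk V) t \<omega>\<bar>)
      \<ge> real n powr (1/4) * z} \<le> 11 * real n * exp (- (1 / (2 * C)) * z)"
    (is "prob ?A \<le> _")
proof -
  \<comment> \<open>The summand 1 in \<open>C\<close> makes \<open>suminf step_bound * x\<close>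
    strictly smaller than \<open>z = C * x\<close>, which is what contradicts the
    \<open>\<ge>\<close> in the event.\<close>
  have C: "C \<ge> 1"
    unfolding C_def using suminf_nonneg[OF summable_step_bound step_bound_nonneg] by simp
  define x where "x = z / C"
  have z_eq: "z = C * x" using C by (simp add: x_def)
  have goal_eq: "- (1 / (2 * C)) * z = - x / 2" using C by (simp add: x_def)
  show ?thesis
  proof (cases "x \<ge> 1")
    case False
    \<comment> \<open>For \<open>x < 1\<close> the claimed bound is at least \<open>11 / 2\<close>
      and so exceeds every probability.\<close>
    have "1 / 2 \<le> exp (- x / 2)"
      using exp_ge_add_one_self[of "- x / 2"] False by simp
    then have "11 * 1 * (1 / 2) \<le> 11 * real n * exp (- x / 2)"
      using n by (intro mult_mono) auto
    then show ?thesis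
      unfolding goal_eq using prob_le_1[of ?A] by linarith
  next
    case x: True
    let ?B = "(\<Union>m. level_bad V n x m) \<union> {\<omega> \<in> space M. \<not> good V \<omega>}"
    have N: "real n powr (1/4) > 0" using n by simp
    have meas: "(\<Union>m. level_bad V n x m) \<in> events"
      using level_bad_measurable[OF V] by auto
    have meas2: "{\<omega> \<in> space M. \<not> good V \<omega>} \<in> events"
      using good_measurable[OF V] by (rule sets.sets_Collect_neg)
    have "?A \<subseteq> ?B"
    proof (rule ccontr)
      assume "\<not> ?A \<subseteq> ?B"
      then obtain \<omega> where \<omega>: "\<omega> \<in> space M" "good V \<omega>" "\<omega> \<notin> (\<Union>m. level_bad V n x m)"
        and S: "(SUP t\<in>{0..real n}. \<bar>limit_process V t \<omega> - linear_interpolation (walk V) t \<omega>\<bar>) \<ge> real n powr (1/4) * z"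
        by auto
      have "(SUP t\<in>{0..real n}. \<bar>limit_process V t \<omega> - linear_interpolation (walk V) t \<omega>\<bar>)
          \<le> suminf step_bound * x * real n powr (1/4)"
        using limit_process_close[OF \<omega>(1,2) n x \<omega>(3)] by (intro cSUP_least) auto
      also have "\<dots> < C * x * real n powr (1/4)"
        using x N by (auto simp: C_def intro!: mult_strict_right_mono)
      finally show False using S by (simp add: z_eq mult_ac)
    qed
    then have "prob ?A \<le> prob ?B"
      using meas meas2 by (intro finite_measure_mono) auto
    also have "\<dots> \<le> prob (\<Union>m. level_bad V n x m) + prob {\<omega> \<in> space M. \<not> good V \<omega>}"
      using meas meas2 by (rule measure_Un_le)
    also have "prob {\<omega> \<in> space M. \<not> good V \<omega>} = 0"
      using AE_good[OF V] prob_eq_0[OF meas2] by auto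
    also have "prob (\<Union>m. level_bad V n x m) + 0 \<le> 121 * (real n)\<^sup>2 * exp (- x)"
      using prob_level_bad_UN[OF V n x] by simp
    also have "exp (- x) = (exp (- x / 2))\<^sup>2"
      by (simp add: power2_eq_square flip: exp_add)
    finally have 1: "prob ?A \<le> (11 * real n * exp (- x / 2))\<^sup>2"
      by (simp add: power_mult_distrib)
    \<comment> \<open>As \<open>p\<^sup>2 \<le> p\<close> for a probability, a bound by a square
      passes to its root: halving the decay rate lowers \<open>n\<^sup>2\<close> to
      \<open>n\<close>.\<close>
    have "(prob ?A)\<^sup>2 \<le> prob ?A"
      by (simp add: power2_eq_square mult_left_le)
    then have "prob ?A \<le> 11 * real n * exp (- x / 2)"
      by (rule power2_le_imp_le[OF order_trans[OF _ 1]]) simp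
    then show ?thesis unfolding goal_eq .
  qed
qed

end

section \<open>Independence and normal laws in the limit\<close>

context prob_space
begin

text \<open>Half-lines form a generating system stable under intersection, and their joint
  probabilities are integrals of products of indicators, which converge by dominated convergence.
  Convergence is assumed for the indicators because these jump at \<open>x\<close>.\<close>

lemma indep_vars_limit:
  fixes Y :: "nat \<Rightarrow> 'i \<Rightarrow> 'a \<Rightarrow> real" and Z :: "'i \<Rightarrow> 'a \<Rightarrow> real"
  assumes Y: "\<And>m. indep_vars (\<lambda>_. borel) (Y m) I"
    and Z: "\<And>i. i \<in> I \<Longrightarrow> random_variable borel (Z i)"
    and lim: "\<And>i x. i \<in> I \<Longrightarrow>
      AE \<omega> in M. (\<lambda>m. indicator {..x} (Y m i \<omega>) :: real) \<longlonglongrightarrow> indicator {..x} (Z i \<omega>)"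
  shows "indep_vars (\<lambda>_. borel) Z I"
proof -
  let ?G = "\<lambda>i. {Z i -` A \<inter> space M | A. A \<in> range atMost}"
  have Y_meas: "random_variable borel (Y m i)" if "i \<in> I" for m i
    using Y that by (auto simp: indep_vars_def2)
  have prob_Int: "prob (\<Inter>j\<in>J. X j -` A j \<inter> space M) = (LINT \<omega>|M. (\<Prod>j\<in>J. indicator (A j) (X j \<omega>)))"
    if "finite J" "J \<noteq> {}" for J and A :: "'i \<Rightarrow> real set" and X :: "'i \<Rightarrow> 'a \<Rightarrow> real"
  proof -
    have "(\<Prod>j\<in>J. indicator (A j) (X j \<omega>) :: real) = indicator (\<Inter>j\<in>J. X j -` A j \<inter> space M) \<omega>"
      if "\<omega> \<in> space M" for \<omega>
      using \<open>finite J\<close> \<open>J \<noteq> {}\<close> that by (auto simp: indicator_def prod_eq_1_iff split: if_splits)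
    then have "(LINT \<omega>|M. (\<Prod>j\<in>J. indicator (A j) (X j \<omega>)))
        = (LINT \<omega>|M. indicator (\<Inter>j\<in>J. X j -` A j \<inter> space M) \<omega> :: real)"
      by (intro Bochner_Integration.integral_cong) auto
    also have "\<dots> = prob ((\<Inter>j\<in>J. X j -` A j \<inter> space M) \<inter> space M)"
      by (rule Bochner_Integration.integral_indicator)
    also have "(\<Inter>j\<in>J. X j -` A j \<inter> space M) \<inter> space M = (\<Inter>j\<in>J. X j -` A j \<inter> space M)"
      using \<open>J \<noteq> {}\<close> by auto
    finally show ?thesis by simp
  qed
  have "indep_sets ?G I"
  proof (rule indep_setsI)
    show "?G i \<subseteq> events" if "i \<in> I" for i
      using Z[OF that] by (auto intro!: measurable_sets)
  next
    fix A J
    assume J: "J \<noteq> {}" "J \<subseteq> I" "finite J" and A: "\<forall>j\<in>J. A j \<in> ?G j"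
    have "\<exists>x. A j = Z j -` {..x} \<inter> space M" if "j \<in> J" for j
    proof -
      have "A j \<in> ?G j"
        using A \<open>j \<in> J\<close> by (rule bspec)
      then show ?thesis
        by (elim CollectE exE conjE rangeE) (rule exI, simp only:)
    qed
    then have "\<forall>j\<in>J. \<exists>x. A j = Z j -` {..x} \<inter> space M" by blast
    then obtain x where A: "\<And>j. j \<in> J \<Longrightarrow> A j = Z j -` {..x j} \<inter> space M"
      by (auto dest!: bchoice)
    \<comment> \<open>The case \<open>K = J\<close> gives the limit of the joint probability, the
      singletons those of its factors.\<close>
    have conv: "(\<lambda>m. prob (\<Inter>j\<in>K. Y m j -` {..x j} \<inter> space M)) \<longlonglongrightarrow> prob (\<Inter>j\<in>K. Z j -` {..x j} \<inter> space M)"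
      if K: "K \<noteq> {}" "K \<subseteq> J" for K
    proof -
      have fin: "finite K" and sub: "\<And>j. j \<in> K \<Longrightarrow> j \<in> I"
        using K J by (auto intro: finite_subset)
      have "(\<lambda>m. LINT \<omega>|M. (\<Prod>j\<in>K. indicator {..x j} (Y m j \<omega>) :: real))
          \<longlonglongrightarrow> (LINT \<omega>|M. (\<Prod>j\<in>K. indicator {..x j} (Z j \<omega>)))"
      proof (rule integral_dominated_convergence[where w = "\<lambda>_. 1"])
        have "AE \<omega> in M. \<forall>j\<in>K. (\<lambda>m. indicator {..x j} (Y m j \<omega>) :: real) \<longlonglongrightarrow> indicator {..x j} (Z j \<omega>)"
          using fin by (intro AE_finite_allI lim sub) auto
        then show "AE \<omega> in M. (\<lambda>m. \<Prod>j\<in>K. indicator {..x j} (Y m j \<omega>) :: real)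
            \<longlonglongrightarrow> (\<Prod>j\<in>K. indicator {..x j} (Z j \<omega>))"
          by eventually_elim (auto intro!: tendsto_prod)
        show "AE \<omega> in M. norm (\<Prod>j\<in>K. indicator {..x j} (Y m j \<omega>) :: real) \<le> 1" for m
          by (auto intro!: prod_le_1 simp: indicator_def abs_prod)
        show "(\<lambda>\<omega>. \<Prod>j\<in>K. indicator {..x j} (Y m j \<omega>) :: real) \<in> borel_measurable M" for m
          using Y_meas[OF sub] by (intro borel_measurable_prod) (auto intro!: borel_measurable_indicator')
        show "(\<lambda>\<omega>. \<Prod>j\<in>K. indicator {..x j} (Z j \<omega>) :: real) \<in> borel_measurable M"
          using Z[OF sub] by (intro borel_measurable_prod) (auto intro!: borel_measurable_indicator')
      qed auto
      then show ?thesis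
        unfolding prob_Int[OF fin K(1)] .
    qed
    have "(\<lambda>m. \<Prod>j\<in>J. prob (Y m j -` {..x j} \<inter> space M)) \<longlonglongrightarrow> (\<Prod>j\<in>J. prob (Z j -` {..x j} \<inter> space M))"
      using conv[of "{j}" for j] by (intro tendsto_prod) auto
    moreover have "(\<Prod>j\<in>J. prob (Y m j -` {..x j} \<inter> space M)) = prob (\<Inter>j\<in>J. Y m j -` {..x j} \<inter> space M)" for m
      using J by (intro indep_varsD[OF Y, symmetric]) auto
    ultimately have "prob (\<Inter>j\<in>J. Z j -` {..x j} \<inter> space M) = (\<Prod>j\<in>J. prob (Z j -` {..x j} \<inter> space M))"
      using LIMSEQ_unique[OF conv[OF J(1) order_refl]] by simp
    then show "prob (\<Inter>j\<in>J. A j) = (\<Prod>j\<in>J. prob (A j))"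
      using A by simp
  qed
  then have "indep_sets (\<lambda>i. sigma_sets (space M) (?G i)) I"
  proof (rule indep_sets_sigma)
    show "Int_stable (?G i)" for i
    proof (rule Int_stableI)
      fix a b assume "a \<in> ?G i" "b \<in> ?G i"
      then obtain x y where "a = Z i -` {..x} \<inter> space M" "b = Z i -` {..y} \<inter> space M" by auto
      then have "a \<inter> b = Z i -` {..min x y} \<inter> space M" by auto
      then show "a \<inter> b \<in> ?G i" by auto
    qed
  qed
  moreover have "{Z i -` A \<inter> space M | A. A \<in> sets borel} = sigma_sets (space M) (?G i)" for i
    using sigma_sets_vimage_commute[of "Z i" "space M" UNIV "range atMost"] by (simp add: borel_eq_atMost)
  ultimately show ?thesis
    using Z unfolding indep_vars_def2 by simp
qed

text \<open>Dominated convergence carries the characteristic functions to that of \<open>Z\<close>;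
  Levy's uniqueness theorem then identifies the law of \<open>Z / sqrt v\<close> as standard
  normal.\<close>

lemma distributed_normal_limit:
  fixes X :: "nat \<Rightarrow> 'a \<Rightarrow> real"
  assumes X [measurable]: "\<And>m. random_variable borel (X m)"
    and Z [measurable]: "random_variable borel Z"
    and lim: "AE \<omega> in M. (\<lambda>m. X m \<omega>) \<longlonglongrightarrow> Z \<omega>"
    and v: "v > 0"
    and char: "\<And>\<theta>. (\<lambda>m. char (distr M borel (X m)) \<theta>) \<longlonglongrightarrow> complex_of_real (exp (- (\<theta>\<^sup>2 * v / 2)))"
  shows "distributed M lborel Z (normal_density 0 (sqrt v))"
proof -
  have char_Z: "char (distr M borel Z) \<theta> = complex_of_real (exp (- (\<theta>\<^sup>2 * v / 2)))" for \<theta>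
  proof (rule LIMSEQ_unique[OF _ char])
    have "(\<lambda>m. LINT \<omega>|M. iexp (\<theta> * X m \<omega>)) \<longlonglongrightarrow> (LINT \<omega>|M. iexp (\<theta> * Z \<omega>))"
    proof (rule integral_dominated_convergence[where w = "\<lambda>_. 1"])
      show "AE \<omega> in M. (\<lambda>m. iexp (\<theta> * X m \<omega>)) \<longlonglongrightarrow> iexp (\<theta> * Z \<omega>)"
        using lim by eventually_elim (intro tendsto_intros)
    qed auto
    then show "(\<lambda>m. char (distr M borel (X m)) \<theta>) \<longlonglongrightarrow> char (distr M borel Z) \<theta>"
      by (simp add: char_def integral_distr)
  qed
  let ?D = "distr M borel (\<lambda>\<omega>. Z \<omega> / sqrt v)"
  have "char ?D \<theta> = char std_normal_distribution \<theta>" for \<theta>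
  proof -
    have "char ?D \<theta> = char (distr M borel Z) (\<theta> / sqrt v)"
      by (simp add: char_def integral_distr)
    then show ?thesis
      using v by (simp add: char_Z char_std_normal_distribution power_divide)
  qed
  moreover have "real_distribution ?D"
    by (simp add: real_distribution_def real_distribution_axioms_def prob_space_distr)
  ultimately have "?D = std_normal_distribution"
    by (intro Levy_uniqueness real_dist_normal_dist) auto
  moreover have "distr M lborel (\<lambda>\<omega>. Z \<omega> / sqrt v) = ?D"
    by (intro distr_cong) auto
  ultimately have "distributed M lborel (\<lambda>\<omega>. Z \<omega> / sqrt v) std_normal_density"
    unfolding distributed_def by auto
  then show ?thesis
    using normal_standard_normal_convert[of "sqrt v" Z 0] v by simp
qed

text \<open>One signed coin contributes \<open>cos (\<theta> * c)\<close>, the mean of two conjugate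
  exponentials; independence multiplies these factors.\<close>

lemma char_fair_coin_sum:
  assumes V: "fair_coins V" and K: "finite K"
  shows "char (distr M borel (\<lambda>\<omega>. \<Sum>k\<in>K. c * coin_sign (V k \<omega>))) \<theta> = complex_of_real (cos (\<theta> * c) ^ card K)"
proof -
  note [measurable] = fair_coins_measurable[OF V]
  have [measurable]: "(\<lambda>\<omega>. coin_sign (V p \<omega>)) \<in> borel_measurable M" for p
    unfolding coin_sign_def by measurable
  have single: "char (distr M borel (\<lambda>\<omega>. c * coin_sign (V k \<omega>))) \<theta> = complex_of_real (cos (\<theta> * c))" for k
  proof -
    have "char (distr M borel (\<lambda>\<omega>. c * coin_sign (V k \<omega>))) \<theta>
        = (LINT \<omega>|M. iexp (\<theta> * (c * coin_sign (V k \<omega>))))"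
      by (simp add: char_def integral_distr)
    also have "\<dots> = (1/2) *\<^sub>R iexp (\<theta> * c) + (1/2) *\<^sub>R iexp (- (\<theta> * c))"
      by (subst fair_coins_integral[OF V, of "\<lambda>b. iexp (\<theta> * (c * coin_sign b))"]) (simp add: coin_sign_def)
    also have "\<dots> = complex_of_real (cos (\<theta> * c))"
      by (simp add: complex_eq_iff Re_exp Im_exp)
    finally show ?thesis .
  qed
  have "indep_vars (\<lambda>_. borel) (\<lambda>k \<omega>. c * coin_sign (V k \<omega>)) K"
    by (rule indep_vars_compose2[OF fair_coins_indep_vars[OF V]]) auto
  then have "char (distr M borel (\<lambda>\<omega>. \<Sum>k\<in>K. c * coin_sign (V k \<omega>))) \<theta>
      = (\<Prod>k\<in>K. char (distr M borel (\<lambda>\<omega>. c * coin_sign (V k \<omega>))) \<theta>)"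
    by (rule char_distr_sum)
  also have "\<dots> = (\<Prod>k\<in>K. complex_of_real (cos (\<theta> * c)))"
    unfolding single ..
  finally show ?thesis by simp
qed

end

text \<open>The central limit theorem for coin sums: \<open>ln (cos u)\<close> behaves like
  \<open>- u\<^sup>2 / 2\<close> at \<open>u = \<theta> / 2 ^ m\<close>, and the exponent divided by
  \<open>4 ^ m\<close> tends to \<open>t - s\<close>. The case \<open>\<theta> = 0\<close> is apart
  because of the division by \<open>u\<^sup>2\<close>.\<close>

lemma cos_power_limit:
  fixes s t \<theta> :: real
  assumes "0 \<le> s" "s \<le> t"
  shows "(\<lambda>m. cos (\<theta> * (1 / 2 ^ m)) ^ (nat \<lfloor>4 ^ m * t\<rfloor> - nat \<lfloor>4 ^ m * s\<rfloor>)) \<longlonglongrightarrow> exp (- (\<theta>\<^sup>2 * (t - s) / 2))"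
proof (cases "\<theta> = 0")
  case False
  define K where "K m = nat \<lfloor>4 ^ m * t\<rfloor> - nat \<lfloor>4 ^ m * s\<rfloor>" for m :: nat
  have floor_lim: "(\<lambda>m. real (nat \<lfloor>4 ^ m * r\<rfloor>) / 4 ^ m) \<longlonglongrightarrow> r" if "r \<ge> 0" for r :: real
  proof (rule tendsto_sandwich[where f = "\<lambda>m. r - 1 / 4 ^ m" and h = "\<lambda>m. r"])
    have b: "4 ^ m * r - 1 \<le> real (nat \<lfloor>4 ^ m * r\<rfloor>)" "real (nat \<lfloor>4 ^ m * r\<rfloor>) \<le> 4 ^ m * r" for m
      using that zero_le_mult_iff[of "4 ^ m" r] by (auto intro: of_nat_floor)
    show "\<forall>\<^sub>F m in sequentially. r - 1 / 4 ^ m \<le> real (nat \<lfloor>4 ^ m * r\<rfloor>) / 4 ^ m"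
      using divide_right_mono[OF b(1), of "4 ^ m" m for m]
      by (intro always_eventually allI) (simp add: diff_divide_distrib)
    show "\<forall>\<^sub>F m in sequentially. real (nat \<lfloor>4 ^ m * r\<rfloor>) / 4 ^ m \<le> r"
      using divide_right_mono[OF b(2), of "4 ^ m" m for m]
      by (intro always_eventually allI) simp
    show "(\<lambda>m. r - 1 / 4 ^ m) \<longlonglongrightarrow> r"
      by real_asymp
  qed simp
  have K_lim: "(\<lambda>m. real (K m) / 4 ^ m) \<longlonglongrightarrow> t - s"
  proof -
    have "nat \<lfloor>4 ^ m * s\<rfloor> \<le> nat \<lfloor>4 ^ m * t\<rfloor>" for m
      using assms by (intro nat_mono floor_mono) simp
    then have "real (K m) / 4 ^ m = real (nat \<lfloor>4 ^ m * t\<rfloor>) / 4 ^ m - real (nat \<lfloor>4 ^ m * s\<rfloor>) / 4 ^ m" for m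
      by (simp add: K_def of_nat_diff diff_divide_distrib)
    then show ?thesis
      using tendsto_diff[OF floor_lim floor_lim, of t s] assms by (simp only: order_trans[OF assms])
  qed
  have u: "(\<lambda>m. \<theta> / 2 ^ m) \<longlonglongrightarrow> 0" by real_asymp
  have "((\<lambda>u::real. ln (cos u) / u\<^sup>2) \<longlongrightarrow> - 1 / 2) (at 0)"
    by real_asymp
  then have ln_lim: "(\<lambda>m. ln (cos (\<theta> / 2 ^ m)) / (\<theta> / 2 ^ m)\<^sup>2) \<longlonglongrightarrow> - 1 / 2"
    by (rule filterlim_compose[of _ _ "at 0"]) (use u False in \<open>simp add: filterlim_at\<close>)
  have "(\<lambda>m. exp (ln (cos (\<theta> / 2 ^ m)) / (\<theta> / 2 ^ m)\<^sup>2 * \<theta>\<^sup>2 * (real (K m) / 4 ^ m)))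
      \<longlonglongrightarrow> exp (- 1 / 2 * \<theta>\<^sup>2 * (t - s))"
    by (intro tendsto_intros ln_lim K_lim)
  moreover have "\<forall>\<^sub>F m in sequentially.
      exp (ln (cos (\<theta> / 2 ^ m)) / (\<theta> / 2 ^ m)\<^sup>2 * \<theta>\<^sup>2 * (real (K m) / 4 ^ m)) = cos (\<theta> / 2 ^ m) ^ K m"
  proof -
    have "(\<lambda>m. cos (\<theta> / 2 ^ m)) \<longlonglongrightarrow> cos 0" by (intro tendsto_intros u)
    then have "\<forall>\<^sub>F m in sequentially. cos (\<theta> / 2 ^ m) > 0"
      by (rule order_tendstoD) simp
    then show ?thesis
    proof eventually_elim
      case (elim m)
      have "(4::real) ^ m = 2 ^ m * 2 ^ m" by (simp flip: power_mult_distrib)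
      then have "ln (cos (\<theta> / 2 ^ m)) / (\<theta> / 2 ^ m)\<^sup>2 * \<theta>\<^sup>2 * (real (K m) / 4 ^ m)
          = real (K m) * ln (cos (\<theta> / 2 ^ m))"
        using False by (simp add: power2_eq_square field_simps)
      then show ?case
        using elim by (simp add: exp_of_nat_mult)
    qed
  qed
  ultimately show ?thesis
    by (simp add: K_def tendsto_cong mult_ac)
qed simp

lemma coin_sign_eq_iff [simp]: "coin_sign b = 1 \<longleftrightarrow> b" "coin_sign b = - 1 \<longleftrightarrow> \<not> b"
  by (auto simp: coin_sign_def)

section \<open>Brownian motion\<close>

text \<open>Endpoints are rounded to whole steps, so that adjacent time intervals use disjoint sets
  of coins; increments of the interpolated path could share the coin at a common endpoint.\<close>

definition block :: "real \<Rightarrow> real \<Rightarrow> nat \<Rightarrow> nat set" where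
  "block s t m = {nat \<lfloor>4 ^ m * s\<rfloor>..<nat \<lfloor>4 ^ m * t\<rfloor>}"

definition walk_increment :: "(nat \<times> nat \<Rightarrow> 'a \<Rightarrow> bool) \<Rightarrow> real \<Rightarrow> real \<Rightarrow> nat \<Rightarrow> 'a \<Rightarrow> real" where
  "walk_increment V s t m \<omega> = (\<Sum>k\<in>block s t m. 1 / 2 ^ m * coin_sign ((refine ^^ m) V (0, k) \<omega>))"

context prob_space
begin

text \<open>Rounding to whole steps instead of interpolating changes the scaled walk by at most
  \<open>1 / 2 ^ m\<close>.\<close>

lemma walk_increment_tendsto:
  assumes \<omega>: "\<omega> \<in> space M" "good V \<omega>" and st: "0 \<le> s" "s \<le> t"
  shows "(\<lambda>m. walk_increment V s t m \<omega>) \<longlonglongrightarrow> limit_process V t \<omega> - limit_process V s \<omega>"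
proof -
  have *: "(\<lambda>m. walk ((refine ^^ m) V) (nat \<lfloor>4 ^ m * r\<rfloor>) \<omega> / 2 ^ m) \<longlonglongrightarrow> limit_process V r \<omega>" if "r \<ge> 0" for r
  proof -
    have "(\<lambda>m. walk ((refine ^^ m) V) (nat \<lfloor>4 ^ m * r\<rfloor>) \<omega> / 2 ^ m - scaled_walk V m r \<omega>) \<longlonglongrightarrow> 0"
    proof (rule Lim_null_comparison)
      show "\<forall>\<^sub>F m in sequentially. norm (walk ((refine ^^ m) V) (nat \<lfloor>4 ^ m * r\<rfloor>) \<omega> / 2 ^ m - scaled_walk V m r \<omega>) \<le> 1 / 2 ^ m"
      proof (intro always_eventually allI)
        fix m
        have "\<bar>linear_interpolation (walk ((refine ^^ m) V)) (4 ^ m * r) \<omega> - walk ((refine ^^ m) V) (nat \<lfloor>4 ^ m * r\<rfloor>) \<omega>\<bar> \<le> 1"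
          using that by (intro linear_interpolation_walk_floor) simp
        then show "norm (walk ((refine ^^ m) V) (nat \<lfloor>4 ^ m * r\<rfloor>) \<omega> / 2 ^ m - scaled_walk V m r \<omega>) \<le> 1 / 2 ^ m"
          by (simp add: scaled_walk_def abs_minus_commute divide_right_mono flip: diff_divide_distrib)
      qed
      show "(\<lambda>m. 1 / 2 ^ m :: real) \<longlonglongrightarrow> 0"
        by real_asymp
    qed
    from tendsto_add[OF this limit_process_tendsto[OF \<omega> that]] show ?thesis by simp
  qed
  have "walk_increment V s t m \<omega> = walk ((refine ^^ m) V) (nat \<lfloor>4 ^ m * t\<rfloor>) \<omega> / 2 ^ m
      - walk ((refine ^^ m) V) (nat \<lfloor>4 ^ m * s\<rfloor>) \<omega> / 2 ^ m" for m
  proof -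
    have "nat \<lfloor>4 ^ m * s\<rfloor> \<le> nat \<lfloor>4 ^ m * t\<rfloor>"
      using st by (intro nat_mono floor_mono) simp
    from walk_diff[OF this, of "(refine ^^ m) V" \<omega>] show ?thesis
      unfolding walk_increment_def block_def sum_distrib_left[symmetric]
      by (simp flip: diff_divide_distrib)
  qed
  then show ?thesis
    using st by (simp add: tendsto_diff *)
qed

lemma walk_increment_measurable:
  assumes V: "fair_coins V"
  shows "random_variable borel (walk_increment V s t m)"
proof -
  note [measurable] = fair_coins_measurable[OF fair_coins_refine_iter[OF V]]
  show ?thesis
    unfolding walk_increment_def[abs_def] coin_sign_def by measurable
qed

lemma limit_process_increment_normal:
  assumes V: "fair_coins V" and st: "0 \<le> s" "s < t"
  shows "distributed M lborel (\<lambda>\<omega>. limit_process V t \<omega> - limit_process V s \<omega>)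
    (normal_density 0 (sqrt (t - s)))"
proof (rule distributed_normal_limit[where X = "walk_increment V s t"])
  note [measurable] = limit_process_measurable[OF V]
  show "random_variable borel (\<lambda>\<omega>. limit_process V t \<omega> - limit_process V s \<omega>)"
    by measurable
  show "AE \<omega> in M. (\<lambda>m. walk_increment V s t m \<omega>) \<longlonglongrightarrow> limit_process V t \<omega> - limit_process V s \<omega>"
    using AE_good[OF V] by (rule AE_mp) (use st in \<open>auto intro!: AE_I2 walk_increment_tendsto\<close>)
  show "(\<lambda>m. char (distr M borel (walk_increment V s t m)) \<theta>)
      \<longlonglongrightarrow> complex_of_real (exp (- (\<theta>\<^sup>2 * (t - s) / 2)))" for \<theta>
  proof -
    have "fair_coins (\<lambda>k. (refine ^^ m) V (0, k))" for m
      by (intro fair_coins_reindex[OF fair_coins_refine_iter[OF V]] injI) simp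
    then have "char (distr M borel (walk_increment V s t m)) \<theta> =
        complex_of_real (cos (\<theta> * (1 / 2 ^ m)) ^ (nat \<lfloor>4 ^ m * t\<rfloor> - nat \<lfloor>4 ^ m * s\<rfloor>))" for m
      unfolding walk_increment_def[abs_def] by (subst char_fair_coin_sum) (auto simp: block_def)
    then show ?thesis
      using tendsto_of_real[OF cos_power_limit[of s t \<theta>]] st by simp
  qed
qed (use st walk_increment_measurable[OF V] in auto)

text \<open>At each level the increments use disjoint blocks of coins and are independent, which
  \<open>indep_vars_limit\<close> carries over: a normal increment almost surely avoids the jump
  \<open>x\<close> of the indicator.\<close>

lemma limit_process_increments_indep:
  fixes t :: "nat \<Rightarrow> real"
  assumes V: "fair_coins V" and t: "0 \<le> t 0" "\<And>i. i < k \<Longrightarrow> t i \<le> t (Suc i)"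
  shows "indep_vars (\<lambda>_. borel) (\<lambda>i \<omega>. limit_process V (t (Suc i)) \<omega> - limit_process V (t i) \<omega>) {..<k}"
proof (rule indep_vars_limit[where Y = "\<lambda>m i. walk_increment V (t i) (t (Suc i)) m"])
  have mono: "t i \<le> t j" if "i \<le> j" "j \<le> k" for i j
    using that by (induction rule: dec_induct) (use t(2) in \<open>auto intro: order_trans\<close>)
  have nonneg: "0 \<le> t i" if "i \<le> k" for i
    using mono[of 0 i] that t(1) by simp
  note [measurable] = limit_process_measurable[OF V]
  show "random_variable borel (\<lambda>\<omega>. limit_process V (t (Suc i)) \<omega> - limit_process V (t i) \<omega>)" for i
    by measurable
  show "indep_vars (\<lambda>_. borel) (\<lambda>i. walk_increment V (t i) (t (Suc i)) m) {..<k}" for m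
  proof -
    let ?W = "\<lambda>j. (refine ^^ m) V (0, j)" and ?K = "\<lambda>i. block (t i) (t (Suc i)) m"
    have "fair_coins ?W"
      by (intro fair_coins_reindex[OF fair_coins_refine_iter[OF V]] injI) simp
    then have ind: "indep_vars (\<lambda>_. borel) (\<lambda>j \<omega>. coin_sign (?W j \<omega>)) UNIV"
      by (rule fair_coins_sign_indep_vars)
    have "?K i \<inter> ?K j = {}" if "i < j" "j < k" for i j
    proof -
      have "nat \<lfloor>4 ^ m * t (Suc i)\<rfloor> \<le> nat \<lfloor>4 ^ m * t j\<rfloor>"
        using that by (intro nat_mono floor_mono mult_left_mono mono) auto
      then show ?thesis by (auto simp: block_def)
    qed
    then have disj: "disjoint_family_on ?K {..<k}"
      unfolding disjoint_family_on_def by (metis Int_commute lessThan_iff nat_neq_iff)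
    have "indep_vars (\<lambda>_. borel) (\<lambda>i \<omega>. (\<lambda>f. \<Sum>j\<in>?K i. 1 / 2 ^ m * f j) (restrict (\<lambda>j. coin_sign (?W j \<omega>)) (?K i))) {..<k}"
      by (rule indep_vars_compose2[OF indep_vars_restrict[OF ind _ disj]]) auto
    then show ?thesis
      by (simp add: walk_increment_def[abs_def])
  qed
  fix i x assume i: "i \<in> {..<k}"
  let ?Z = "\<lambda>\<omega>. limit_process V (t (Suc i)) \<omega> - limit_process V (t i) \<omega>"
  show "AE \<omega> in M. (\<lambda>m. indicator {..x} (walk_increment V (t i) (t (Suc i)) m \<omega>) :: real) \<longlonglongrightarrow> indicator {..x} (?Z \<omega>)"
  proof (cases "t i = t (Suc i)")
    case True
    \<comment> \<open>A degenerate interval has no normal density, but its block is empty and both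
      increments are constantly 0.\<close>
    then show ?thesis by (simp add: walk_increment_def block_def)
  next
    case False
    then have "t i < t (Suc i)" "0 \<le> t i" using t(2)[of i] i nonneg[of i] by auto
    then have D: "distributed M lborel ?Z (normal_density 0 (sqrt (t (Suc i) - t i)))"
      by (intro limit_process_increment_normal[OF V])
    have "AE z in density lborel (normal_density 0 (sqrt (t (Suc i) - t i))). z \<noteq> x"
      using AE_lborel_singleton[of x] by (subst AE_density) auto
    then have "AE z in distr M lborel ?Z. z \<noteq> x"
      unfolding distributed_distr_eq_density[OF D] .
    then have "AE \<omega> in M. ?Z \<omega> \<noteq> x"
      by (subst (asm) AE_distr_iff) auto
    with AE_good[OF V] AE_space show ?thesis
    proof eventually_elim
      case (elim \<omega>)
      have "(\<lambda>m. walk_increment V (t i) (t (Suc i)) m \<omega>) \<longlonglongrightarrow> ?Z \<omega>"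
        using \<open>t i < _\<close> \<open>0 \<le> t i\<close> elim by (intro walk_increment_tendsto) auto
      moreover have "isCont (indicator {..x} :: real \<Rightarrow> real) (?Z \<omega>)"
        using elim by (simp add: isCont_indicator frontier_def)
      ultimately show ?case
        by (rule isCont_tendsto_compose[rotated])
    qed
  qed
qed

lemma limit_process_brownian:
  assumes V: "fair_coins V"
  shows "standard_brownian_motion (limit_process V)"
proof -
  have "scaled_walk V m 0 \<omega> = 0" for m \<omega>
    by (simp add: scaled_walk_def linear_interpolation_def)
  then have "limit_process V 0 \<omega> = 0" for \<omega>
    by (simp add: limit_process_def)
  then show ?thesis
    unfolding standard_brownian_motion_def
    using limit_process_measurable[OF V] limit_process_continuous
      limit_process_increment_normal[OF V] limit_process_increments_indep[OF V]
    by auto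
qed

lemma walk_simple_random_walk:
  assumes V: "fair_coins V"
  shows "simple_random_walk (walk V)"
  unfolding simple_random_walk_def
proof (intro exI conjI allI ballI impI)
  \<comment> \<open>Steps of the walk are numbered from 1; index 0 is sent to a coin outside row 0,
    which keeps \<open>f\<close> injective.\<close>
  define f where "f i = (case i of 0 \<Rightarrow> (1, 0) | Suc j \<Rightarrow> (0::nat, j))" for i :: nat
  have "inj f"
    by (auto simp: inj_def f_def split: nat.splits)
  then have F: "fair_coins (\<lambda>i. V (f i))"
    by (rule fair_coins_reindex[OF V])
  then show "indep_vars (\<lambda>_. borel) (\<lambda>i \<omega>. coin_sign (V (f i) \<omega>)) {1..}"
    by (rule fair_coins_sign_indep_vars)
  show "prob {\<omega> \<in> space M. coin_sign (V (f i) \<omega>) = 1} = 1 / 2"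
       "prob {\<omega> \<in> space M. coin_sign (V (f i) \<omega>) = - 1} = 1 / 2" for i
    using fair_coins_prob_single[OF F, of i True] fair_coins_prob_single[OF F, of i False]
    by simp_all
  show "walk V n \<omega> = (\<Sum>i = 1..n. coin_sign (V (f i) \<omega>))" for n \<omega>
    unfolding walk_def by (rule sum.reindex_bij_witness[of _ "\<lambda>i. i - 1" Suc]) (auto simp: f_def split: nat.splits)
qed

end

section \<open>Existence of the coins and conclusion\<close>

lemma exists_fair_coins:
  "\<exists>(M :: (nat \<Rightarrow> real) measure) (V :: nat \<times> nat \<Rightarrow> (nat \<Rightarrow> real) \<Rightarrow> bool).
     prob_space M \<and> prob_space.fair_coins M V"
proof -
  \<comment> \<open>The coins are real numbers 0 and 1 to fit the sample space
    \<open>nat \<Rightarrow> real\<close>; \<open>prod_encode\<close> lays out the array as one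
    sequence.\<close>
  define R where "R = measure_pmf (pmf_of_set {0, 1 :: real})"
  interpret product_prob_space "\<lambda>_. R" "UNIV :: nat set"
    unfolding R_def product_prob_space_def product_prob_space_axioms_def product_sigma_finite_def
    by (auto intro: measure_pmf.sigma_finite_measure_axioms measure_pmf.prob_space_axioms)
  let ?M = "PiM UNIV (\<lambda>_::nat. R)"
  define V where "V p \<omega> = (\<omega> (prod_encode p) = 1)" for p and \<omega> :: "nat \<Rightarrow> real"
  have "P.fair_coins V"
    unfolding P.fair_coins_def
  proof (intro conjI allI impI)
    show "V p \<in> measurable ?M (count_space UNIV)" for p
    proof -
      have "(\<lambda>\<omega>. \<omega> (prod_encode p)) \<in> measurable ?M R" by measurable
      moreover have "(\<lambda>x. x = 1) \<in> measurable R (count_space UNIV)" by (simp add: R_def)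
      ultimately show ?thesis unfolding V_def[abs_def] by (rule measurable_compose)
    qed
  next
    fix J :: "(nat \<times> nat) set" and a assume J: "finite J"
    let ?X = "\<lambda>i. {x. (x = 1) = a (prod_decode i)} :: real set"
    have "measure R (?X i) = 1 / 2" for i
    proof -
      have "{0, 1} \<inter> ?X i = {if a (prod_decode i) then 1 else 0}" by auto
      then show ?thesis
        unfolding R_def by (subst measure_pmf_of_set) simp_all
    qed
    then have "emeasure R (?X i) = ennreal (1 / 2)" for i
      unfolding R_def measure_pmf.emeasure_eq_measure by (simp only:)
    then have "emeasure ?M {\<omega> \<in> space ?M. \<forall>i\<in>prod_encode ` J. \<omega> i \<in> ?X i} = ennreal (1 / 2) ^ card J"
      using J by (subst emeasure_PiM_Collect) (auto simp: R_def card_image inj_prod_encode)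
    also have "{\<omega> \<in> space ?M. \<forall>i\<in>prod_encode ` J. \<omega> i \<in> ?X i} = {\<omega> \<in> space ?M. \<forall>p\<in>J. V p \<omega> = a p}"
      by (auto simp: V_def)
    also have "ennreal (1 / 2) ^ card J = ennreal ((1 / 2) ^ card J)"
      by (rule ennreal_power) simp
    finally show "P.prob {\<omega> \<in> space ?M. \<forall>p\<in>J. V p \<omega> = a p} = (1 / 2) ^ card J"
      by (rule measure_eq_emeasure_eq_ennreal[rotated]) simp
  qed
  then show ?thesis
    using P.prob_space_axioms by blast
qed

theorem theorem5p1:
  "\<exists>(M :: (nat \<Rightarrow> real) measure) (B :: real \<Rightarrow> (nat \<Rightarrow> real) \<Rightarrow> real)
     (S :: nat \<Rightarrow> (nat \<Rightarrow> real) \<Rightarrow> real).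
     prob_space M \<and>
     prob_space.standard_brownian_motion M B \<and>
     prob_space.simple_random_walk M S \<and>
     (\<forall>g :: nat \<Rightarrow> real. (\<forall>n\<ge>1. g n \<ge> 1) \<longrightarrow>
        (\<exists>b K :: real. b > 0 \<and> K > 0 \<and>
           (\<forall>n\<ge>1.
              measure M {\<omega> \<in> space M.
                (SUP t\<in>{0..real n}. \<bar>B t \<omega> - linear_interpolation S t \<omega>\<bar>)
                  \<ge> real n powr (1 / 4) * g n}
              \<le> K * real n * exp (- b * g n))))"
proof -
  obtain M :: "(nat \<Rightarrow> real) measure" and V :: "nat \<times> nat \<Rightarrow> (nat \<Rightarrow> real) \<Rightarrow> bool"
    where "prob_space M" and V: "prob_space.fair_coins M V"
    using exists_fair_coins by blast
  interpret prob_space M by fact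
  \<comment> \<open>The rate stems from \<open>prob_limit_process_far\<close>, which holds for all
    \<open>z \<ge> 1\<close>; with \<open>z = g n\<close>, the same \<open>b\<close> and 11 serve
    every \<open>g\<close>.\<close>
  define b where "b = 1 / (2 * (suminf step_bound + 1))"
  have "b > 0"
    using suminf_nonneg[OF summable_step_bound step_bound_nonneg] by (simp add: b_def)
  show ?thesis
  proof (intro exI[of _ M] exI[of _ "limit_process V"] exI[of _ "walk V"] conjI allI impI)
    fix g :: "nat \<Rightarrow> real" assume g: "\<forall>n\<ge>1. g n \<ge> 1"
    show "\<exists>b K :: real. b > 0 \<and> K > 0 \<and> (\<forall>n\<ge>1. prob {\<omega> \<in> space M.
        (SUP t\<in>{0..real n}. \<bar>limit_process V t \<omega> - linear_interpolation (walk V) t \<omega>\<bar>)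
          \<ge> real n powr (1 / 4) * g n} \<le> K * real n * exp (- b * g n))"
      using prob_limit_process_far[OF V] g \<open>b > 0\<close>
      by (intro exI[of _ b] exI[of _ 11]) (simp add: b_def)
  qed (intro prob_space_axioms limit_process_brownian walk_simple_random_walk V)+
qed

end
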